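(* Consider the optimal costs $J_\infty$, $J_s$ and $\tilde{J}_s$ ($s=1,2,\dots$) defined in the context, and let $N_0\ge 1$ be an integer such that $J_{N_0}$ is finite. 1) Suppose that for every $s\ge 1$: (B0) $\mathcal{X}^s\subset\mathbb{R}^{ns}$ and $\mathcal{U}^s\subset\mathbb{R}^{ms}$ are closed and convex; (B1) $i_s(\mathcal{X}^s)\subset\mathcal{X}^{s+1}$ and $i_s(\mathcal{U}^s)\subset\mathcal{U}^{s+1}$; (B2) $\eta_x\in\mathcal{X}^s$ implies $(I_n\otimes\tau^s(t))^{\mathsf T}\eta_x\in\mathcal{X}$ for all $t\in[0,\infty)$, and $\eta_u\in\mathcal{U}^s$ implies $(I_m\otimes\tau^s(t))^{\mathsf T}\eta_u\in\mathcal{U}$ for all $t\in[0,\infty)$. Then the sequence $J_s$ is monotonically decreasing for $s\ge N_0$, converges as $s\to\infty$, and is bounded below by $J_\infty$. The optimizers $\tilde{x}^s$ and $\tilde{u}^s$ corresponding to $J_s$ converge strongly in $L^2_n$, respectively $L^2_m$, as $s\to\infty$. 2) Suppose that for every $s\ge 1$: (C0) $\tilde{\mathcal{X}}^s\subset\mathbb{R}^{ns}$ and $\tilde{\mathcal{U}}^s\subset\mathbb{R}^{ms}$ are closed and convex; (C1) $\pi_s(\tilde{\mathcal{X}}^{s+1})\subset\tilde{\mathcal{X}}^s$ and $\pi_s(\tilde{\mathcal{U}}^{s+1})\subset\tilde{\mathcal{U}}^s$; (C2) for each $x\in L^2_n$ with $x(t)\in\mathcal{X}$ for all $t\in[0,\infty)$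 it holds that $\pi^s(x)\in\tilde{\mathcal{X}}^s$, and for each $u\in L^2_m$ with $u(t)\in\mathcal{U}$ for all $t\in[0,\infty)$ it holds that $\pi^s(u)\in\tilde{\mathcal{U}}^s$. Then $\tilde{J}_s$ is monotonically increasing for $s\ge 1$, converges as $s\to\infty$, and is bounded above by $J_\infty$.
   Context: "Monotonically decreasing/increasing" is meant in the non-strict sense. The infimum over an empty set is $+\infty$. Spaces. $L^2_q$ is the space of square integrable functions $[0,\infty)\to\mathbb{R}^q$ (Lebesgue measure) with $\|x\|_2^2:=\int_0^\infty x^{\mathsf T}x\,\mathrm{d}t$. Data. $A\in\mathbb{R}^{n\times n}$, $B\in\mathbb{R}^{n\times m}$, $x_0\in\mathbb{R}^n$; $\mathcal{X}\subset\mathbb{R}^n$ and $\mathcal{U}\subset\mathbb{R}^m$ are closed and convex and contain $0$. Underlying problem. $J_\infty:=\inf\ \frac12\|x\|_2^2+\frac12\|u\|_2^2$ over $x\in L^2_n$, $u\in L^2_m$ with $\dot x\in L^2_n$, subject to $\dot x(t)=Ax(t)+Bu(t)$, $x(0)=x_0$, $x(t)\in\mathcal{X}$, $u(t)\in\mathcal{U}$ for all $t\in[0,\infty)$. It is assumed throughout that $J_\infty$ is finite and that the corresponding minimizers $x,u$ (exist and) are unique. Basis functions. $\tau_1,\tau_2,\dots\in L^2_1$ are orthonormal in $L^2_1$ (in particular linearly independent). Write $\tau^s(t):=(\tau_1(t),\dots,\tau_s(t))\in\mathbb{R}^s$ (column vector). For each $s\ge1$ there is a matrix $M=M_s\in\mathbb{R}^{s\times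 s}$, all of whose eigenvalues have strictly negative real parts, with $\dot\tau^s(t)=M_s\tau^s(t)$ for all $t\in[0,\infty)$. Parametrization. For $\eta_x\in\mathbb{R}^{ns}$, $\eta_u\in\mathbb{R}^{ms}$ put $\tilde{x}^s(t,\eta_x):=(I_n\otimes\tau^s(t))^{\mathsf T}\eta_x$ and $\tilde{u}^s(t,\eta_u):=(I_m\otimes\tau^s(t))^{\mathsf T}\eta_u$, where $\otimes$ is the Kronecker product. The superscript $s$ and the argument $\eta$ are dropped when clear. Maps. The inclusion $i_s:\mathbb{R}^{ns}\to\mathbb{R}^{n(s+1)}$ is defined by $\tilde{x}^s(t,\eta_x)=\tilde{x}^{s+1}(t,i_s(\eta_x))$ for all $t\in[0,\infty)$ and $\eta_x\in\mathbb{R}^{ns}$. The projections are $\pi^s:L^2_n\to\mathbb{R}^{ns}$, $\pi^s(x):=\int_0^\infty(I_n\otimes\tau^s)x\,\mathrm{d}t$, and $\pi_s:\mathbb{R}^{n(s+1)}\to\mathbb{R}^{ns}$, $\pi_s(\eta_x):=\pi^s(\tilde{x}^{s+1}(\cdot,\eta_x))$. The same symbols $i_s,\pi^s,\pi_s$ denote the analogous maps with $n$ replaced by $m$ (for inputs). First approximation. Given sets $\mathcal{X}^s\subset\mathbb{R}^{ns}$, $\mathcal{U}^s\subset\mathbb{R}^{ms}$ for each $s\ge1$, $J_s:=\inf\ \frac12\|\tilde x\|_2^2+\frac12\|\tilde u\|_2^2$ over $\eta_x\in\mathcal{X}^s$, $\eta_u\in\mathcal{U}^s$ subject to $\int_0^\infty(I_n\otimes\tau^s)(A\tilde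 x+B\tilde u-\dot{\tilde x})\,\mathrm{d}t=0$ and $\tilde x(0)-x_0=0$, where $\tilde x=\tilde x^s(\cdot,\eta_x)$, $\tilde u=\tilde u^s(\cdot,\eta_u)$. The optimizers $\tilde x^s,\tilde u^s$ corresponding to $J_s$ are the trajectories of the minimizing parameters. Second approximation. Given sets $\tilde{\mathcal{X}}^s\subset\mathbb{R}^{ns}$, $\tilde{\mathcal{U}}^s\subset\mathbb{R}^{ms}$ for each $s\ge1$, $\tilde J_s:=\inf\ \frac12\|\tilde x\|_2^2+\frac12\|\tilde u\|_2^2$ over $\eta_x\in\tilde{\mathcal{X}}^s$, $\eta_u\in\tilde{\mathcal{U}}^s$ subject to $\int_0^\infty(I_n\otimes\tau^s)(A\tilde x+B\tilde u-\dot{\tilde x})\,\mathrm{d}t-(I_n\otimes\tau^s(0))(\tilde x(0)-x_0)=0$. *)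

theory Defs
  imports "HOL-Analysis.Analysis" "HOL-Analysis.Finite_Function_Topology" "Jordan_Normal_Form.Char_Poly"
begin

no_notation Matrix.vec_index (infixl "$" 100)
no_notation Matrix.scalar_prod (infix "\<bullet>" 70)

text \<open>
  Elements are represented by functions on all of \<^typ>\<open>real\<close>; only their values on
  \<open>[0, \<infinity>)\<close> matter.
\<close>

definition L2 :: "(real \<Rightarrow> 'a::euclidean_space) set" where
  "L2 = {x. x \<in> borel_measurable (lebesgue_on {0..}) \<and>
            integrable (lebesgue_on {0..}) (\<lambda>t. x t \<bullet> x t)}"

definition L2_norm :: "(real \<Rightarrow> 'a::euclidean_space) \<Rightarrow> real" where
  "L2_norm x = sqrt (LINT t|lebesgue_on {0..}. x t \<bullet> x t)"

text \<open>
  \<open>y\<close> is the derivative of \<open>x\<close> in the sense of \<open>H\<^sup>1\<close>: \<open>x\<close> is the (locally absolutely continuous)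
  primitive of a square integrable function. An input is merely square integrable, so a classical
  derivative of the state need not exist at every time.
\<close>

definition has_L2_derivative ::
    "(real \<Rightarrow> 'a::euclidean_space) \<Rightarrow> (real \<Rightarrow> 'a) \<Rightarrow> bool" where
  "has_L2_derivative x y \<longleftrightarrow> y \<in> L2 \<and> (\<forall>t\<ge>0. (y has_integral (x t - x 0)) {0..t})"

definition cost ::
    "(real \<Rightarrow> 'a::euclidean_space) \<Rightarrow> (real \<Rightarrow> 'b::euclidean_space) \<Rightarrow> real" where
  "cost x u = 1/2 * (L2_norm x)\<^sup>2 + 1/2 * (L2_norm u)\<^sup>2"

definition feasible_inf ::
    "real^'n^'n \<Rightarrow> real^'m^'n \<Rightarrow> real^'n \<Rightarrow> (real^'n) set \<Rightarrow> (real^'m) set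
      \<Rightarrow> ((real \<Rightarrow> real^'n) \<times> (real \<Rightarrow> real^'m)) set" where
  "feasible_inf A B x0 X U =
     {(x, u). x \<in> L2 \<and> u \<in> L2 \<and>
        (\<exists>x'. has_L2_derivative x x' \<and>
              (AE t in lebesgue_on {0..}. x' t = A *v x t + B *v u t)) \<and>
        x 0 = x0 \<and> (\<forall>t\<ge>0. x t \<in> X \<and> u t \<in> U)}"

definition J_inf ::
    "real^'n^'n \<Rightarrow> real^'m^'n \<Rightarrow> real^'n \<Rightarrow> (real^'n) set \<Rightarrow> (real^'m) set \<Rightarrow> ereal" where
  "J_inf A B x0 X U = (INF (x, u) \<in> feasible_inf A B x0 X U. ereal (cost x u))"

definition minimizers_inf ::
    "real^'n^'n \<Rightarrow> real^'m^'n \<Rightarrow> real^'n \<Rightarrow> (real^'n) set \<Rightarrow> (real^'m) set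
      \<Rightarrow> ((real \<Rightarrow> real^'n) \<times> (real \<Rightarrow> real^'m)) set" where
  "minimizers_inf A B x0 X U =
     {(x, u) \<in> feasible_inf A B x0 X U. ereal (cost x u) = J_inf A B x0 X U}"

text \<open>
  Basis functions are numbered from \<open>0\<close>: \<open>\<tau> k\<close> is the function usually written
  \<open>\<tau>\<close> with index \<open>k + 1\<close>, so that \<open>\<tau>\<^sup>s = (\<tau> 0, \<dots>, \<tau> (s - 1))\<close>.
\<close>

definition tau_vec :: "(nat \<Rightarrow> real \<Rightarrow> real) \<Rightarrow> nat \<Rightarrow> real \<Rightarrow> real Matrix.vec" where
  "tau_vec \<tau> s t = Matrix.vec s (\<lambda>k. \<tau> k t)"

definition orthonormal_L2 :: "(nat \<Rightarrow> real \<Rightarrow> real) \<Rightarrow> bool" where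
  "orthonormal_L2 \<tau> \<longleftrightarrow> (\<forall>k. \<tau> k \<in> L2) \<and>
     (\<forall>j k. (LINT t|lebesgue_on {0..}. \<tau> j t * \<tau> k t) = (if j = k then 1 else 0))"

definition exp_stable_basis :: "(nat \<Rightarrow> real \<Rightarrow> real) \<Rightarrow> bool" where
  "exp_stable_basis \<tau> \<longleftrightarrow>
     (\<forall>s\<ge>1. \<exists>M \<in> carrier_mat s s.
        (\<forall>z. eigenvalue (map_mat complex_of_real M) z \<longrightarrow> Re z < 0) \<and>
        (\<forall>t\<ge>0. \<forall>j<s.
           (\<tau> j has_real_derivative Matrix.vec_index (M *\<^sub>v tau_vec \<tau> s t) j) (at t within {0..})))"

text \<open>
  Since \<open>s\<close> varies, \<open>\<real>\<close> to the power \<open>n * s\<close> is the subspace of those finitely supported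
  functions on \<open>'n \<times> nat\<close> that vanish at \<open>(i, k)\<close> for \<open>k \<ge> s\<close>. The index \<open>(i, k)\<close> stands for
  the position \<open>k\<close> inside block \<open>i\<close>, i.e. the row of the Kronecker product of the identity with
  \<open>\<tau>\<^sup>s\<close> whose only nonzero entry is \<open>\<tau> k\<close> in column \<open>i\<close>. Closedness and convexity are the
  ones of the normed space \<open>('n \<times> nat, real) poly_mapping\<close>; on each of these finite-dimensional subspaces they
  are the usual ones.
\<close>

type_synonym 'n param = "('n \<times> nat, real) poly_mapping"

definition param_space :: "nat \<Rightarrow> 'n param set" where
  "param_space s = {\<eta>. Poly_Mapping.keys \<eta> \<subseteq> UNIV \<times> {..<s}}"

definition mk_param :: "nat \<Rightarrow> ('n::finite \<Rightarrow> nat \<Rightarrow> real) \<Rightarrow> 'n param" where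
  "mk_param s f = Abs_poly_mapping (\<lambda>(i, k). if k < s then f i k else 0)"

lemma lookup_mk_param:
  "Poly_Mapping.lookup (mk_param s f) (i, k) = (if k < s then f i k else 0)"
proof -
  have "{x. (case x of (i, k) \<Rightarrow> if k < s then f i k else 0) \<noteq> 0} \<subseteq> UNIV \<times> {..<s}"
    by (auto split: if_splits)
  then have "finite {x. (case x of (i, k) \<Rightarrow> if k < s then f i k else 0) \<noteq> 0}"
    by (rule finite_subset) simp
  then show ?thesis
    by (simp add: mk_param_def Abs_poly_mapping_inverse)
qed

lemma mk_param_in_param_space: "mk_param s f \<in> param_space s"
  by (auto simp: param_space_def in_keys_iff lookup_mk_param split: if_splits)

text \<open>The matrix-vector products of \<open>I \<otimes> \<tau>\<^sup>s(t)\<close> with \<open>v\<close>, and of its transpose with \<open>\<eta>\<close>.\<close>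

definition kron_tau :: "(nat \<Rightarrow> real \<Rightarrow> real) \<Rightarrow> nat \<Rightarrow> real \<Rightarrow> real^'n \<Rightarrow> 'n param" where
  "kron_tau \<tau> s t v = mk_param s (\<lambda>i k. \<tau> k t * v $ i)"

definition traj :: "(nat \<Rightarrow> real \<Rightarrow> real) \<Rightarrow> nat \<Rightarrow> 'n param \<Rightarrow> real \<Rightarrow> real^'n" where
  "traj \<tau> s \<eta> t = (\<chi> i. \<Sum>k<s. \<tau> k t * Poly_Mapping.lookup \<eta> (i, k))"

text \<open>The integral of \<open>(I \<otimes> \<tau>\<^sup>s(t)) x(t)\<close> over the half line, taken entrywise.\<close>

definition proj :: "(nat \<Rightarrow> real \<Rightarrow> real) \<Rightarrow> nat \<Rightarrow> (real \<Rightarrow> real^'n) \<Rightarrow> 'n param" where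
  "proj \<tau> s x = mk_param s (\<lambda>i k. LINT t|lebesgue_on {0..}. \<tau> k t * x t $ i)"

definition incl :: "(nat \<Rightarrow> real \<Rightarrow> real) \<Rightarrow> nat \<Rightarrow> ('n::finite) param \<Rightarrow> 'n param" where
  "incl \<tau> s \<eta> =
     (THE \<eta>'. \<eta>' \<in> param_space (Suc s) \<and> (\<forall>t\<ge>0. traj \<tau> s \<eta> t = traj \<tau> (Suc s) \<eta>' t))"

definition proj_step :: "(nat \<Rightarrow> real \<Rightarrow> real) \<Rightarrow> nat \<Rightarrow> ('n::finite) param \<Rightarrow> 'n param" where
  "proj_step \<tau> s \<eta> = proj \<tau> s (traj \<tau> (Suc s) \<eta>)"

definition residual ::
    "real^'n^'n \<Rightarrow> real^'m^'n \<Rightarrow> (nat \<Rightarrow> real \<Rightarrow> real) \<Rightarrow> nat \<Rightarrow> 'n param \<Rightarrow> 'm param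
      \<Rightarrow> real \<Rightarrow> real^'n" where
  "residual A B \<tau> s \<eta>x \<eta>u t =
     A *v traj \<tau> s \<eta>x t + B *v traj \<tau> s \<eta>u t
       - vector_derivative (traj \<tau> s \<eta>x) (at t within {0..})"

definition param_cost ::
    "(nat \<Rightarrow> real \<Rightarrow> real) \<Rightarrow> nat \<Rightarrow> ('n::finite) param \<Rightarrow> ('m::finite) param \<Rightarrow> real" where
  "param_cost \<tau> s \<eta>x \<eta>u = cost (traj \<tau> s \<eta>x) (traj \<tau> s \<eta>u)"

definition feasible1 ::
    "real^'n^'n \<Rightarrow> real^'m^'n \<Rightarrow> real^'n \<Rightarrow> (nat \<Rightarrow> real \<Rightarrow> real)
      \<Rightarrow> (nat \<Rightarrow> 'n param set) \<Rightarrow> (nat \<Rightarrow> 'm param set) \<Rightarrow> nat \<Rightarrow> ('n param \<times> 'm param) set" where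
  "feasible1 A B x0 \<tau> XS US s =
     {(\<eta>x, \<eta>u). \<eta>x \<in> XS s \<and> \<eta>u \<in> US s \<and>
        proj \<tau> s (residual A B \<tau> s \<eta>x \<eta>u) = 0 \<and>
        traj \<tau> s \<eta>x 0 - x0 = 0}"

definition J1 ::
    "real^'n^'n \<Rightarrow> real^'m^'n \<Rightarrow> real^'n \<Rightarrow> (nat \<Rightarrow> real \<Rightarrow> real)
      \<Rightarrow> (nat \<Rightarrow> 'n param set) \<Rightarrow> (nat \<Rightarrow> 'm param set) \<Rightarrow> nat \<Rightarrow> ereal" where
  "J1 A B x0 \<tau> XS US s =
     (INF (\<eta>x, \<eta>u) \<in> feasible1 A B x0 \<tau> XS US s. ereal (param_cost \<tau> s \<eta>x \<eta>u))"

definition minimizers1 ::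
    "real^'n^'n \<Rightarrow> real^'m^'n \<Rightarrow> real^'n \<Rightarrow> (nat \<Rightarrow> real \<Rightarrow> real)
      \<Rightarrow> (nat \<Rightarrow> 'n param set) \<Rightarrow> (nat \<Rightarrow> 'm param set) \<Rightarrow> nat \<Rightarrow> ('n param \<times> 'm param) set" where
  "minimizers1 A B x0 \<tau> XS US s =
     {(\<eta>x, \<eta>u) \<in> feasible1 A B x0 \<tau> XS US s.
        ereal (param_cost \<tau> s \<eta>x \<eta>u) = J1 A B x0 \<tau> XS US s}"

definition feasible2 ::
    "real^'n^'n \<Rightarrow> real^'m^'n \<Rightarrow> real^'n \<Rightarrow> (nat \<Rightarrow> real \<Rightarrow> real)
      \<Rightarrow> (nat \<Rightarrow> 'n param set) \<Rightarrow> (nat \<Rightarrow> 'm param set) \<Rightarrow> nat \<Rightarrow> ('n param \<times> 'm param) set" where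
  "feasible2 A B x0 \<tau> XT UT s =
     {(\<eta>x, \<eta>u). \<eta>x \<in> XT s \<and> \<eta>u \<in> UT s \<and>
        proj \<tau> s (residual A B \<tau> s \<eta>x \<eta>u)
          - kron_tau \<tau> s 0 (traj \<tau> s \<eta>x 0 - x0) = 0}"

definition J2 ::
    "real^'n^'n \<Rightarrow> real^'m^'n \<Rightarrow> real^'n \<Rightarrow> (nat \<Rightarrow> real \<Rightarrow> real)
      \<Rightarrow> (nat \<Rightarrow> 'n param set) \<Rightarrow> (nat \<Rightarrow> 'm param set) \<Rightarrow> nat \<Rightarrow> ereal" where
  "J2 A B x0 \<tau> XT UT s =
     (INF (\<eta>x, \<eta>u) \<in> feasible2 A B x0 \<tau> XT UT s. ereal (param_cost \<tau> s \<eta>x \<eta>u))"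

end

theory Submission
  imports Defs
begin

text \<open>
  The derivatives of the basis functions stay in their span, so the residual of a trajectory in
  \<open>span \<tau>\<^sup>s\<close> lies in that span and its projection vanishes only if the residual does. Feasible points
  of the first approximation therefore solve the differential equation exactly, and the feasible sets
  increase with \<open>s\<close> inside the feasible set of the full problem. By the parallelogram law the
  squared distance of the optimizers for \<open>s \<le> r\<close> is at most a multiple of \<open>J\<^sub>s - J\<^sub>r\<close>, so they form a
  Cauchy sequence in the complete space \<open>L\<^sup>2\<close>.

  After integration by parts the constraint of the second approximation says that the equation
  holds weakly against the functions \<open>\<tau>\<^sup>s\<close>. It involves only the coefficients with index below \<open>s\<close>,
  so orthogonal projection maps feasible points to feasible points, and it does not increase the cost
  by Bessel's inequality.
\<close>

subsection \<open>Square integrable functions on the half line\<close>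

text \<open>By orthonormality a parameter and its trajectory have the same norm, so every cost is
  half a sum of squared coefficients. The parameter spaces are nested in one type, where
  \<open>incl\<close> acts as the identity and \<open>proj_step\<close> as a truncation; what
  remains is to find the equations that the coefficients satisfy. The second constraint hinges on
  \<open>D_transpose\<close>: integrating the derivative of \<tau> k times \<tau> l gives D + D^T =
  - \<tau>(0) \<tau>(0)^T. The boundary term of the constraint cancels exactly this rank-one part;
  row k of the rest sees only indices l \<le> k and is the same for every s > k. The analytic
  obstacle is the full problem: its state is merely a primitive of a square integrable function, so
  integration by parts on the half line has to be proved in that generality. In the first problem a
  single estimate, \<open>almost_minimizers1_close\<close>, serves three times: for uniqueness of
  minimizers, for their existence, and for the Cauchy property of the optimizers as s grows.\<close>

abbreviation (input) halfline :: "real measure" where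
  "halfline \<equiv> lebesgue_on {0..}"

lemma L2_measurable: "x \<in> L2 \<Longrightarrow> x \<in> borel_measurable halfline"
  by (simp add: L2_def)

lemma L2_integrable_inner:
  assumes "x \<in> L2" "y \<in> L2"
  shows "integrable halfline (\<lambda>t. x t \<bullet> y t)"
proof (rule Bochner_Integration.integrable_bound)
  show "integrable halfline (\<lambda>t. x t \<bullet> x t + y t \<bullet> y t)"
    using assms by (simp add: L2_def)
  show "(\<lambda>t. x t \<bullet> y t) \<in> borel_measurable halfline"
    using assms by (intro borel_measurable_inner L2_measurable)
  show "AE t in halfline. norm (x t \<bullet> y t) \<le> norm (x t \<bullet> x t + y t \<bullet> y t)"
  proof (rule AE_I2)
    fix t
    have "\<bar>x t \<bullet> y t\<bar> \<le> norm (x t) * norm (y t)"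
      by (rule Cauchy_Schwarz_ineq2)
    also have "\<dots> \<le> (norm (x t))\<^sup>2 + (norm (y t))\<^sup>2"
    proof -
      have "0 \<le> norm (x t) * norm (y t)" by simp
      then show ?thesis using sum_squares_bound[of "norm (x t)" "norm (y t)"] by linarith
    qed
    finally show "norm (x t \<bullet> y t) \<le> norm (x t \<bullet> x t + y t \<bullet> y t)"
      by (simp add: power2_norm_eq_inner)
  qed
qed

lemma L2_integrable_mult:
  fixes f g :: "real \<Rightarrow> real"
  shows "f \<in> L2 \<Longrightarrow> g \<in> L2 \<Longrightarrow> integrable halfline (\<lambda>t. f t * g t)"
  using L2_integrable_inner[of f g] by simp

lemma L2_zero: "(\<lambda>t. 0) \<in> L2"
  by (simp add: L2_def)

lemma L2_add:
  assumes "x \<in> L2" "y \<in> L2" shows "(\<lambda>t. x t + y t) \<in> L2"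
  using assms L2_integrable_inner[OF assms] L2_integrable_inner[OF assms(2,1)]
  by (auto simp: L2_def inner_add_left inner_add_right)

lemma L2_scaleR: "x \<in> L2 \<Longrightarrow> (\<lambda>t. c *\<^sub>R x t) \<in> L2"
  by (auto simp: L2_def)

lemma L2_diff:
  assumes "x \<in> L2" "y \<in> L2" shows "(\<lambda>t. x t - y t) \<in> L2"
  using L2_add[OF assms(1) L2_scaleR[OF assms(2), of "- 1"]] by simp

lemma L2_sum: "(\<And>i. i \<in> I \<Longrightarrow> x i \<in> L2) \<Longrightarrow> (\<lambda>t. \<Sum>i\<in>I. x i t) \<in> L2"
  by (induction I rule: infinite_finite_induct) (auto intro: L2_zero L2_add)

lemma L2_comp:
  fixes x :: "real \<Rightarrow> real^'n"
  assumes "x \<in> L2" shows "(\<lambda>t. x t $ i) \<in> L2"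
proof -
  have m: "(\<lambda>t. x t \<bullet> axis i 1) \<in> borel_measurable halfline"
    using L2_measurable[OF assms] by (intro borel_measurable_inner) auto
  have "integrable halfline (\<lambda>t. (x t $ i) \<bullet> (x t $ i))"
  proof (rule Bochner_Integration.integrable_bound)
    show "integrable halfline (\<lambda>t. x t \<bullet> x t)" using assms by (simp add: L2_def)
    show "(\<lambda>t. x t $ i \<bullet> x t $ i) \<in> borel_measurable halfline"
      using m by (simp add: inner_axis)
    show "AE t in halfline. norm (x t $ i \<bullet> x t $ i) \<le> norm (x t \<bullet> x t)"
      using component_le_norm_cart[of "x _" i]
      by (auto intro!: AE_I2 simp: power2_norm_eq_inner[symmetric] abs_le_square_iff[symmetric] power2_eq_square[symmetric])
  qed
  with m show ?thesis by (simp add: L2_def inner_axis)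
qed

lemma L2_vec:
  fixes x :: "real \<Rightarrow> real^'n"
  assumes "\<And>i. (\<lambda>t. x t $ i) \<in> L2" shows "x \<in> L2"
proof -
  have "(\<lambda>t. \<Sum>i\<in>UNIV. (x t $ i) *\<^sub>R axis i (1::real)) \<in> borel_measurable halfline"
    by (intro borel_measurable_sum borel_measurable_scaleR borel_measurable_const L2_measurable assms)
  moreover have "(\<lambda>t. \<Sum>i\<in>UNIV. (x t $ i) *\<^sub>R axis i (1::real)) = x"
    by (auto simp: fun_eq_iff Finite_Cartesian_Product.vec_eq_iff axis_def if_distrib cong: if_cong)
  moreover have "integrable halfline (\<lambda>t. x t \<bullet> x t)"
    unfolding inner_vec_def using assms by (auto simp: L2_def)
  ultimately show ?thesis by (simp add: L2_def)
qed

lemma L2_matrix_vector_mult: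
  fixes M :: "real^'q^'p"
  assumes "x \<in> L2" shows "(\<lambda>t. M *v x t) \<in> L2"
proof (rule L2_vec)
  show "(\<lambda>t. (M *v x t) $ i) \<in> L2" for i
    unfolding matrix_vector_mult_def
    using L2_sum[of UNIV "\<lambda>j t. (M $ i $ j) *\<^sub>R x t $ j"] L2_scaleR[OF L2_comp[OF assms]] by simp
qed

lemma L2_norm_nonneg: "0 \<le> L2_norm x"
  by (simp add: L2_norm_def)

lemma L2_norm_square: "(L2_norm x)\<^sup>2 = (LINT t|halfline. x t \<bullet> x t)"
  by (simp add: L2_norm_def)

lemma L2_norm_minus_commute: "L2_norm (\<lambda>t. x t - y t) = L2_norm (\<lambda>t. y t - x t)"
  by (simp add: L2_norm_def power2_norm_eq_inner[symmetric] norm_minus_commute)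

lemma L2_norm_square_cart:
  fixes x :: "real \<Rightarrow> real^'n"
  assumes "x \<in> L2"
  shows "(L2_norm x)\<^sup>2 = (\<Sum>i\<in>UNIV. LINT t|halfline. x t $ i * x t $ i)"
  unfolding L2_norm_square inner_vec_def
  using L2_integrable_mult[OF L2_comp[OF assms] L2_comp[OF assms]] by (simp add: Bochner_Integration.integral_sum)

section \<open>Completeness of the space of square integrable functions\<close>

lemma L2_nn_integral:
  assumes "x \<in> L2"
  shows "(\<integral>\<^sup>+ t. ennreal ((norm (x t))\<^sup>2) \<partial>halfline) = ennreal ((L2_norm x)\<^sup>2)"
  unfolding L2_norm_square power2_norm_eq_inner
  using assms by (intro nn_integral_eq_integral) (auto simp: L2_def)

text \<open>Fatou's lemma yields a bound on a nonnegative integral only. This converts such a bound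
  into membership in \<open>L2\<close> together with a norm estimate.\<close>

lemma L2_nn_integral_le:
  assumes x: "x \<in> borel_measurable halfline" and "c \<ge> 0"
    and le: "(\<integral>\<^sup>+ t. ennreal ((norm (x t))\<^sup>2) \<partial>halfline) \<le> ennreal (c\<^sup>2)"
  shows "x \<in> L2" "L2_norm x \<le> c"
proof -
  have "integrable halfline (\<lambda>t. (norm (x t))\<^sup>2)"
  proof (rule integrableI_bounded)
    show "(\<integral>\<^sup>+ t. ennreal (norm ((norm (x t))\<^sup>2)) \<partial>halfline) < \<infinity>"
      using le by (simp add: le_less_trans[OF _ ennreal_less_top])
  qed (use x in measurable)
  with x show *: "x \<in> L2" by (simp add: L2_def power2_norm_eq_inner)
  have "(L2_norm x)\<^sup>2 \<le> c\<^sup>2"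
    using le by (simp add: L2_nn_integral[OF *])
  then show "L2_norm x \<le> c" using \<open>c \<ge> 0\<close> by (rule power2_le_imp_le)
qed

text \<open>The half line has infinite measure, so the increments d n need not be integrable.
  Instead their squares are summed with weights 1 / q^n growing slowly enough that the weighted
  series still has a finite integral, hence is finite almost everywhere. There it dominates the
  norms of the increments up to a geometric series.\<close>

lemma geometric_Cauchy_AE_convergent:
  fixes f :: "nat \<Rightarrow> real \<Rightarrow> 'a::euclidean_space"
  assumes f: "\<And>n. f n \<in> L2"
    and le: "\<And>n. L2_norm (\<lambda>t. f (Suc n) t - f n t) \<le> (1/2) ^ n"
  shows "AE t in halfline. convergent (\<lambda>n. f n t)"
proof -
  define d where "d n t = f (Suc n) t - f n t" for n t
  \<comment> \<open>The squared norm of d n is at most (1/4)^n = q^(4n), so dividing it by q^n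
    leaves a term below q^n.\<close>
  define q :: real where "q = sqrt (1/2)"
  have q: "0 < q" "q < 1" "q\<^sup>2 = 1/2" by (auto simp: q_def)
  have d: "d n \<in> L2" for n unfolding d_def by (intro L2_diff f)
  have [measurable]: "d n \<in> borel_measurable halfline" for n by (rule L2_measurable[OF d])
  have "(\<integral>\<^sup>+ t. ennreal ((norm (d n t))\<^sup>2 / q ^ n) \<partial>halfline) \<le> ennreal (q ^ n)" for n
  proof -
    have "(\<integral>\<^sup>+ t. ennreal ((norm (d n t))\<^sup>2 / q ^ n) \<partial>halfline)
        = (\<integral>\<^sup>+ t. ennreal (1 / q ^ n) * ennreal ((norm (d n t))\<^sup>2) \<partial>halfline)"
      using q by (intro nn_integral_cong) (simp add: ennreal_mult[symmetric])
    also have "\<dots> = ennreal (1 / q ^ n) * ennreal ((L2_norm (d n))\<^sup>2)"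
      by (subst nn_integral_cmult) (auto simp: L2_nn_integral[OF d])
    also have "\<dots> = ennreal ((L2_norm (d n))\<^sup>2 / q ^ n)"
      using q by (simp add: ennreal_mult[symmetric])
    also have "\<dots> \<le> ennreal (q ^ n)"
    proof (rule ennreal_leI)
      have "(L2_norm (d n))\<^sup>2 \<le> ((1/2) ^ n)\<^sup>2"
        using le[of n] by (intro power_mono L2_norm_nonneg) (simp add: d_def[abs_def])
      also have "((1/2) ^ n)\<^sup>2 = (q ^ n)\<^sup>2 * (q ^ n)\<^sup>2"
      proof -
        have "(1/2) ^ n = (q ^ n)\<^sup>2"
          unfolding q(3)[symmetric] by (simp add: power_mult[symmetric] mult.commute)
        then show ?thesis by (simp only: power2_eq_square)
      qed
      also have "\<dots> \<le> (q ^ n)\<^sup>2 * 1"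
        using q by (intro mult_left_mono) (auto simp: power_le_one)
      finally show "(L2_norm (d n))\<^sup>2 / q ^ n \<le> q ^ n"
        using q by (simp add: divide_le_eq power2_eq_square)
    qed
    finally show ?thesis .
  qed
  then have "(suminf (\<lambda>n. \<integral>\<^sup>+ t. ennreal ((norm (d n t))\<^sup>2 / q ^ n) \<partial>halfline)) \<le> suminf (\<lambda>n. ennreal (q ^ n))"
    by (intro suminf_le) auto
  also have "\<dots> < \<infinity>"
    using q by (subst suminf_ennreal2) (auto intro: summable_geometric)
  finally have "(\<integral>\<^sup>+ t. (suminf (\<lambda>n. ennreal ((norm (d n t))\<^sup>2 / q ^ n))) \<partial>halfline) \<noteq> \<infinity>"
    by (subst nn_integral_suminf) auto
  then have "AE t in halfline. (suminf (\<lambda>n. ennreal ((norm (d n t))\<^sup>2 / q ^ n))) \<noteq> \<infinity>"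
    by (intro nn_integral_PInf_AE) auto
  then show ?thesis
  proof eventually_elim
    case (elim t)
    then have "summable (\<lambda>n. (norm (d n t))\<^sup>2 / q ^ n)"
      using q by (intro summable_suminf_not_top) auto
    then have "summable (\<lambda>n. q ^ n + (norm (d n t))\<^sup>2 / q ^ n)"
      using q by (intro summable_add summable_geometric) auto
    \<comment> \<open>This is 2ab \<le> a^2 + b^2 with a = q^n and b = norm (d n t), divided by
      q^n.\<close>
    moreover have "norm (d n t) \<le> q ^ n + (norm (d n t))\<^sup>2 / q ^ n" for n
    proof -
      have "2 * q ^ n * norm (d n t) \<le> (q ^ n)\<^sup>2 + (norm (d n t))\<^sup>2"
        by (rule sum_squares_bound)
      moreover have "0 \<le> norm (d n t) * q ^ n" using q by simp
      moreover have "2 * q ^ n * norm (d n t) = norm (d n t) * q ^ n + norm (d n t) * q ^ n" by simp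
      ultimately have "norm (d n t) * q ^ n \<le> (q ^ n)\<^sup>2 + (norm (d n t))\<^sup>2"
        by linarith
      then have "norm (d n t) \<le> ((q ^ n)\<^sup>2 + (norm (d n t))\<^sup>2) / q ^ n"
        using q by (simp add: pos_le_divide_eq)
      then show ?thesis using q by (simp add: add_divide_distrib power2_eq_square)
    qed
    ultimately have "summable (\<lambda>n. d n t)"
      by (intro summable_comparison_test[of "\<lambda>n. d n t"]) auto
    then have "convergent (\<lambda>n. f 0 t + (\<Sum>k<n. d k t))"
      by (intro convergent_add convergent_const) (simp add: summable_iff_convergent)
    moreover have "f 0 t + (\<Sum>k<n. d k t) = f n t" for n
      using sum_lessThan_telescope[of "\<lambda>k. f k t" n] by (simp add: d_def)
    ultimately show ?case by simp
  qed
qed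

text \<open>A fast subsequence converges almost everywhere and defines the limit g. Fatou's lemma
  along this subsequence then compares each fixed f n with g directly: a bound on the distances from
  f n to all late f m passes to the distance from f n to g. This gives both membership of g and
  convergence of the whole sequence.\<close>

lemma L2_complete:
  fixes f :: "nat \<Rightarrow> real \<Rightarrow> 'a::euclidean_space"
  assumes f: "\<And>n. f n \<in> L2"
    and Cauchy: "\<And>e. e > 0 \<Longrightarrow> \<exists>N. \<forall>m\<ge>N. \<forall>n\<ge>N. L2_norm (\<lambda>t. f m t - f n t) \<le> e"
  shows "\<exists>g\<in>L2. (\<lambda>n. L2_norm (\<lambda>t. f n t - g t)) \<longlonglongrightarrow> 0"
proof -
  obtain N where N: "\<And>k m n. m \<ge> N k \<Longrightarrow> n \<ge> N k \<Longrightarrow> L2_norm (\<lambda>t. f m t - f n t) \<le> (1/2) ^ k"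
    using Cauchy[of "(1/2) ^ k" for k] by (atomize_elim, intro choice) auto
  \<comment> \<open>Adding up all N j makes both r k and r (Suc k) at least N k, as consecutive
    terms must be close; the summand k makes r unbounded.\<close>
  define r where "r k = k + (\<Sum>j\<le>k. N j)" for k
  have r_ge: "r k \<ge> N k" "r k \<ge> k" "r (Suc k) \<ge> N k" for k
  proof -
    have "N k \<le> (\<Sum>j\<le>k. N j)" by (rule member_le_sum) auto
    then show "r k \<ge> N k" "r k \<ge> k" "r (Suc k) \<ge> N k" by (auto simp: r_def)
  qed
  have "AE t in halfline. convergent (\<lambda>k. f (r k) t)"
    by (rule geometric_Cauchy_AE_convergent) (auto intro: f N r_ge)
  \<comment> \<open>Where the subsequence diverges, which happens on a null set only,
    \<open>lim\<close> is some unspecified value.\<close>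
  define g where "g t = lim (\<lambda>k. f (r k) t)" for t
  have fm [measurable]: "f n \<in> borel_measurable halfline" for n by (rule L2_measurable[OF f])
  have gm [measurable]: "g \<in> borel_measurable halfline"
    unfolding g_def by (rule borel_measurable_lim_metric) auto
  have bound: "f n - g \<in> L2" "L2_norm (f n - g) \<le> e"
    if "e > 0" "\<And>m. m \<ge> K \<Longrightarrow> L2_norm (\<lambda>t. f n t - f m t) \<le> e" for n e K
  proof -
    have "(\<integral>\<^sup>+ t. ennreal ((norm ((f n - g) t))\<^sup>2) \<partial>halfline)
        = (\<integral>\<^sup>+ t. liminf (\<lambda>k. ennreal ((norm (f n t - f (r k) t))\<^sup>2)) \<partial>halfline)"
    proof (rule nn_integral_cong_AE)
      show "AE t in halfline. ennreal ((norm ((f n - g) t))\<^sup>2) = liminf (\<lambda>k. ennreal ((norm (f n t - f (r k) t))\<^sup>2))"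
        using \<open>AE t in halfline. convergent (\<lambda>k. f (r k) t)\<close>
      proof eventually_elim
        case (elim t)
        then have "(\<lambda>k. f (r k) t) \<longlonglongrightarrow> g t"
          by (simp add: g_def convergent_LIMSEQ_iff)
        then have "(\<lambda>k. ennreal ((norm (f n t - f (r k) t))\<^sup>2)) \<longlonglongrightarrow> ennreal ((norm ((f n - g) t))\<^sup>2)"
          by (auto intro!: tendsto_intros)
        then show ?case
          by (intro lim_imp_Liminf[symmetric]) auto
      qed
    qed
    also have "\<dots> \<le> liminf (\<lambda>k. \<integral>\<^sup>+ t. ennreal ((norm (f n t - f (r k) t))\<^sup>2) \<partial>halfline)"
      by (rule nn_integral_liminf) auto
    also have "\<dots> \<le> ennreal (e\<^sup>2)"
    proof (rule Liminf_le)
      have "\<forall>\<^sub>F k in sequentially. K \<le> k" by (rule eventually_ge_at_top)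
      then show "\<forall>\<^sub>F k in sequentially. (\<integral>\<^sup>+ t. ennreal ((norm (f n t - f (r k) t))\<^sup>2) \<partial>halfline) \<le> ennreal (e\<^sup>2)"
      proof eventually_elim
        case (elim k)
        then have "L2_norm (\<lambda>t. f n t - f (r k) t) \<le> e"
          using that(2) r_ge(2)[of k] by simp
        then show ?case
          by (subst L2_nn_integral) (auto intro!: L2_diff f ennreal_leI power_mono L2_norm_nonneg)
      qed
    qed simp
    finally have le: "(\<integral>\<^sup>+ t. ennreal ((norm ((f n - g) t))\<^sup>2) \<partial>halfline) \<le> ennreal (e\<^sup>2)" .
    have "f n - g \<in> borel_measurable halfline"
      unfolding fun_diff_def by measurable
    from L2_nn_integral_le[OF this less_imp_le[OF \<open>e > 0\<close>] le]
    show "f n - g \<in> L2" "L2_norm (f n - g) \<le> e" .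
  qed
  have "g \<in> L2"
  proof -
    obtain K where "\<And>m n. m \<ge> K \<Longrightarrow> n \<ge> K \<Longrightarrow> L2_norm (\<lambda>t. f m t - f n t) \<le> 1"
      using Cauchy[of 1] by auto
    then have "f K - g \<in> L2" by (intro bound(1)[where K = K and e = 1]) auto
    from L2_diff[OF f[of K] this] show ?thesis by simp
  qed
  moreover have "(\<lambda>n. L2_norm (\<lambda>t. f n t - g t)) \<longlonglongrightarrow> 0"
  proof (rule LIMSEQ_I)
    fix e :: real assume "e > 0"
    then obtain K where K: "\<And>m n. m \<ge> K \<Longrightarrow> n \<ge> K \<Longrightarrow> L2_norm (\<lambda>t. f m t - f n t) \<le> e / 2"
      using Cauchy[of "e / 2"] by auto
    have "norm (L2_norm (\<lambda>t. f n t - g t) - 0) < e" if "n \<ge> K" for n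
    proof -
      have "L2_norm (f n - g) \<le> e / 2"
        using K that \<open>e > 0\<close> by (intro bound(2)[where K = K]) auto
      then show ?thesis
        using \<open>e > 0\<close> by (simp add: fun_diff_def abs_of_nonneg[OF L2_norm_nonneg])
    qed
    then show "\<exists>no. \<forall>n\<ge>no. norm (L2_norm (\<lambda>t. f n t - g t) - 0) < e" by blast
  qed
  ultimately show ?thesis by blast
qed

subsection \<open>Integration by parts\<close>

text \<open>The function \<open>f\<close> vanishes at infinity: a limit exists because \<open>g\<close> is integrable, and it is
  zero because \<open>f\<close> is integrable.\<close>

lemma halfline_integral_derivative:
  fixes f g :: "real \<Rightarrow> real"
  assumes f: "integrable halfline f" and g: "integrable halfline g"
    and prim: "\<And>t. t \<ge> 0 \<Longrightarrow> (g has_integral (f t - f 0)) {0..t}"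
  shows "(LINT t|halfline. g t) = - f 0"
proof -
  have fa: "f absolutely_integrable_on {0..}" and ga: "g absolutely_integrable_on {0..}"
    using f g by (simp_all add: set_integrable_def integrable_restrict_space)
  define l where "l = f 0 + integral {0..} g"
  have "((\<lambda>b. LINT t:{0..b}|lebesgue. g t) \<longlongrightarrow> (LINT t:{0..}|lebesgue. g t)) at_top"
    by (intro tendsto_set_lebesgue_integral_at_top ga) auto
  also have "(LINT t:{0..}|lebesgue. g t) = integral {0..} g"
    by (rule set_lebesgue_integral_eq_integral(2)[OF ga])
  finally have "((\<lambda>b. LINT t:{0..b}|lebesgue. g t) \<longlongrightarrow> integral {0..} g) at_top" .
  moreover have "\<forall>\<^sub>F b in at_top. (LINT t:{0..b}|lebesgue. g t) = f b - f 0"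
    using eventually_ge_at_top[of "0::real"]
  proof eventually_elim
    case (elim b)
    have "(LINT t:{0..b}|lebesgue. g t) = integral {0..b} g"
      by (intro set_lebesgue_integral_eq_integral(2) absolutely_integrable_on_subinterval[OF ga]) auto
    also have "\<dots> = f b - f 0" by (rule integral_unique[OF prim[OF elim]])
    finally show ?case .
  qed
  ultimately have "((\<lambda>b. f b - f 0) \<longlongrightarrow> integral {0..} g) at_top"
    by (rule Lim_transform_eventually)
  from tendsto_add[OF tendsto_const[of "f 0"] this]
  have lim: "(f \<longlongrightarrow> l) at_top" by (simp add: l_def)
  have "l = 0"
  proof (rule ccontr)
    assume "l \<noteq> 0"
    from tendsto_norm[OF lim] have "((\<lambda>t. \<bar>f t\<bar>) \<longlongrightarrow> \<bar>l\<bar>) at_top" by simp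
    from order_tendstoD(1)[OF this, of "\<bar>l\<bar> / 2"] \<open>l \<noteq> 0\<close>
    obtain b where b: "\<And>t. t \<ge> b \<Longrightarrow> \<bar>f t\<bar> > \<bar>l\<bar> / 2"
      by (auto simp: eventually_at_top_linorder)
    define a where "a = max b 0"
    define I where "I = integral {0..} (\<lambda>t. \<bar>f t\<bar>)"
    have abs: "(\<lambda>t. \<bar>f t\<bar>) absolutely_integrable_on {0..}"
      using set_integrable_abs[OF fa] by simp
    \<comment> \<open>To the right of a the function stays above half the modulus of its limit, so a
      window of length c contributes at least c times that amount.\<close>
    have "c * (\<bar>l\<bar> / 2) \<le> I" if "c \<ge> 0" for c
    proof -
      have "c * (\<bar>l\<bar> / 2) = integral {a..a + c} (\<lambda>t. \<bar>l\<bar> / 2)"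
        using that by simp
      also have "\<dots> \<le> integral {a..a + c} (\<lambda>t. \<bar>f t\<bar>)"
      proof (rule Henstock_Kurzweil_Integration.integral_le)
        show "(\<lambda>t. \<bar>f t\<bar>) integrable_on {a..a + c}"
          by (intro set_lebesgue_integral_eq_integral(1) absolutely_integrable_on_subinterval[OF abs]) (auto simp: a_def)
        show "\<And>t. t \<in> {a..a + c} \<Longrightarrow> \<bar>l\<bar> / 2 \<le> \<bar>f t\<bar>"
          using b by (auto simp: a_def intro: less_imp_le)
      qed (rule integrable_const_ivl)
      also have "\<dots> \<le> I" unfolding I_def
        by (intro integral_subset_le set_lebesgue_integral_eq_integral(1) absolutely_integrable_on_subinterval[OF abs] abs)
          (auto simp: a_def)
      finally show ?thesis .
    qed
    \<comment> \<open>For this c the left side equals \<bar>I\<bar> + 1, which exceeds I.\<close>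
    from this[of "2 * (\<bar>I\<bar> + 1) / \<bar>l\<bar>"] \<open>l \<noteq> 0\<close> show False by simp
  qed
  then show ?thesis
    by (simp add: l_def lebesgue_integral_eq_integral[OF g])
qed

text \<open>Since \<open>x\<close> is only absolutely continuous, the classical rule does not apply. The defect \<open>F\<close>
  satisfies \<open>\<bar>F t - F s\<bar> \<le> 2 C (t - s) \<integral>\<^sub>s\<^sup>t \<bar>y\<bar>\<close>, hence has derivative zero everywhere.\<close>

lemma integration_by_parts_indefinite_integral:
  fixes \<phi> \<phi>' x y :: "real \<Rightarrow> real"
  assumes T: "T \<ge> 0"
    and \<phi>: "\<And>t. t \<in> {0..T} \<Longrightarrow> (\<phi> has_real_derivative \<phi>' t) (at t within {0..T})"
    and \<phi>': "continuous_on {0..T} \<phi>'"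
    and y: "y absolutely_integrable_on {0..T}"
    and prim: "\<And>t. t \<in> {0..T} \<Longrightarrow> (y has_integral (x t - x 0)) {0..t}"
  shows "((\<lambda>t. \<phi> t * y t + \<phi>' t * x t) has_integral (\<phi> T * x T - \<phi> 0 * x 0)) {0..T}"
proof -
  obtain C where C: "\<And>t. t \<in> {0..T} \<Longrightarrow> \<bar>\<phi>' t\<bar> \<le> C" "C \<ge> 0"
  proof -
    have "bounded (\<phi>' ` {0..T})"
      by (intro compact_imp_bounded compact_continuous_image \<phi>') simp
    then obtain C where C: "\<forall>t\<in>{0..T}. \<bar>\<phi>' t\<bar> \<le> C"
      by (auto simp: bounded_iff)
    moreover have "0 \<in> {0..T}" using T by simp
    ultimately have "C \<ge> 0" by (metis abs_ge_zero order_trans)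
    with C show thesis by (intro that) auto
  qed
  have \<phi>_cont: "continuous_on {0..T} \<phi>"
    using \<phi> by (rule DERIV_continuous_on)
  have y_int: "y integrable_on {s..t}" and yabs_int: "(\<lambda>t. \<bar>y t\<bar>) integrable_on {s..t}"
    if "0 \<le> s" "t \<le> T" for s t
  proof -
    have "{s..t} \<subseteq> {0..T}" using that by auto
    from absolutely_integrable_on_subinterval[OF y this]
    show "y integrable_on {s..t}" "(\<lambda>t. \<bar>y t\<bar>) integrable_on {s..t}"
      by (auto simp: absolutely_integrable_on_def)
  qed
  have x_eq: "x t = x 0 + integral {0..t} y" if "t \<in> {0..T}" for t
    using integral_unique[OF prim[OF that]] by simp
  have "continuous_on {0..T} (\<lambda>t. integral {0..t} y)"
    by (rule indefinite_integral_continuous_1) (rule y_int, auto)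
  then have "continuous_on {0..T} (\<lambda>t. x 0 + integral {0..t} y)"
    by (rule continuous_on_add[OF continuous_on_const])
  then have x_cont: "continuous_on {0..T} x"
    by (rule continuous_on_eq) (rule x_eq[symmetric])
  define g where "g t = \<phi> t * y t + \<phi>' t * x t" for t
  have "(\<lambda>t. \<phi> t * y t) absolutely_integrable_on {0..T}"
  proof (rule absolutely_integrable_bounded_measurable_product_real)
    show "\<phi> \<in> borel_measurable (lebesgue_on {0..T})"
      by (rule continuous_imp_measurable_on_sets_lebesgue[OF \<phi>_cont]) simp
    show "bounded (\<phi> ` {0..T})"
      by (intro compact_imp_bounded compact_continuous_image \<phi>_cont) simp
  qed (use y in auto)
  then have "(\<lambda>t. \<phi> t * y t) integrable_on {0..T}"
    by (rule set_lebesgue_integral_eq_integral(1))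
  moreover have "(\<lambda>t. \<phi>' t * x t) integrable_on {0..T}"
    by (intro integrable_continuous_real continuous_intros \<phi>' x_cont)
  ultimately have g_int0: "g integrable_on {0..T}"
    unfolding g_def by (rule Henstock_Kurzweil_Integration.integrable_add)
  have g_int: "g integrable_on {s..t}" if "0 \<le> s" "t \<le> T" for s t
    by (rule integrable_subinterval_real[OF g_int0]) (use that in auto)
  define F where "F t = \<phi> t * x t - integral {0..t} g" for t
  define G where "G t = integral {0..t} (\<lambda>t. \<bar>y t\<bar>)" for t
  have G_cont: "continuous_on {0..T} G"
    unfolding G_def by (rule indefinite_integral_continuous_1) (rule yabs_int, auto)
  have G_diff: "integral {s..t} (\<lambda>t. \<bar>y t\<bar>) = G t - G s" if "0 \<le> s" "s \<le> t" "t \<le> T" for s t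
    using Henstock_Kurzweil_Integration.integral_combine[OF that(1,2) yabs_int[OF order_refl that(3)]] by (simp add: G_def)
  have x_diff: "integral {s..t} y = x t - x s" if "0 \<le> s" "s \<le> t" "t \<le> T" for s t
    using Henstock_Kurzweil_Integration.integral_combine[OF that(1,2) y_int[OF order_refl that(3)]] x_eq[of s] x_eq[of t] that by auto
  \<comment> \<open>The increment of \<phi> x is split as \<phi> t (x t - x s) + (\<phi> t - \<phi>
    s) x s, freezing \<phi> at the right end and x at the left end. Against g this leaves (\<phi> t
    - \<phi> r) y r + \<phi>' r (x s - x r). The first factor is at most C (t - s), the last one at
    most G t - G s; each product integrates to half of the bound.\<close>
  have F_bound: "\<bar>F t - F s\<bar> \<le> 2 * C * (t - s) * (G t - G s)" if st: "0 \<le> s" "s \<le> t" "t \<le> T" for s t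
  proof -
    have h1: "((\<lambda>r. \<phi> t * y r) has_integral \<phi> t * (x t - x s)) {s..t}"
      using y_int[OF st(1,3)] by (intro has_integral_mult_right) (simp add: has_integral_iff x_diff[OF st])
    have "(\<phi>' has_integral (\<phi> t - \<phi> s)) {s..t}"
    proof (rule fundamental_theorem_of_calculus[OF st(2)])
      fix r assume "r \<in> {s..t}"
      then have "(\<phi> has_real_derivative \<phi>' r) (at r within {s..t})"
        using st by (intro DERIV_subset[OF \<phi>]) auto
      then show "(\<phi> has_vector_derivative \<phi>' r) (at r within {s..t})"
        by (simp add: has_real_derivative_iff_has_vector_derivative)
    qed
    then have h2: "((\<lambda>r. \<phi>' r * x s) has_integral (\<phi> t - \<phi> s) * x s) {s..t}"
      by (rule has_integral_mult_left)
    have h3: "(g has_integral (integral {0..t} g - integral {0..s} g)) {s..t}"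
      using g_int[OF st(1,3)] Henstock_Kurzweil_Integration.integral_combine[OF st(1,2) g_int[OF order_refl st(3)]]
      by (simp add: has_integral_iff)
    have h: "((\<lambda>r. \<phi> t * y r + \<phi>' r * x s - g r) has_integral (F t - F s)) {s..t}"
      using has_integral_diff[OF has_integral_add[OF h1 h2] h3]
      by (simp add: F_def algebra_simps)
    have k1: "((\<lambda>r. C * (t - s) * \<bar>y r\<bar>) has_integral C * (t - s) * (G t - G s)) {s..t}"
      using yabs_int[OF st(1,3)] by (intro has_integral_mult_right) (simp add: has_integral_iff G_diff[OF st])
    have k2: "((\<lambda>r. C * (G t - G s)) has_integral (t - s) * (C * (G t - G s))) {s..t}"
      using has_integral_const_real[of "C * (G t - G s)" s t] st by simp
    have k: "((\<lambda>r. C * (t - s) * \<bar>y r\<bar> + C * (G t - G s)) has_integral 2 * C * (t - s) * (G t - G s)) {s..t}"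
      using has_integral_add[OF k1 k2] by (simp add: algebra_simps)
    have "norm (integral {s..t} (\<lambda>r. \<phi> t * y r + \<phi>' r * x s - g r))
        \<le> integral {s..t} (\<lambda>r. C * (t - s) * \<bar>y r\<bar> + C * (G t - G s))"
    proof (rule Henstock_Kurzweil_Integration.integral_norm_bound_integral)
      fix r assume r: "r \<in> {s..t}"
      have "\<bar>\<phi> t - \<phi> r\<bar> \<le> C * \<bar>t - r\<bar>"
        using field_differentiable_bound[OF _ \<phi> , of C t r] C r st by auto
      also have "\<dots> \<le> C * (t - s)"
        using r C(2) by (intro mult_left_mono) auto
      finally have p1: "\<bar>\<phi> t - \<phi> r\<bar> \<le> C * (t - s)" .
      have "\<bar>x s - x r\<bar> = norm (integral {s..r} y)"
        using r st by (subst x_diff) auto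
      also have "\<dots> \<le> integral {s..r} (\<lambda>t. \<bar>y t\<bar>)"
        using r st by (intro Henstock_Kurzweil_Integration.integral_norm_bound_integral y_int yabs_int) auto
      also have "\<dots> \<le> integral {s..t} (\<lambda>t. \<bar>y t\<bar>)"
        using r st by (intro integral_subset_le yabs_int) auto
      finally have p2: "\<bar>x s - x r\<bar> \<le> G t - G s" using G_diff[OF st] by simp
      have "\<phi> t * y r + \<phi>' r * x s - g r = (\<phi> t - \<phi> r) * y r + \<phi>' r * (x s - x r)"
        by (simp add: g_def algebra_simps)
      also have "norm \<dots> \<le> \<bar>\<phi> t - \<phi> r\<bar> * \<bar>y r\<bar> + \<bar>\<phi>' r\<bar> * \<bar>x s - x r\<bar>"
        by (simp add: abs_mult[symmetric] abs_triangle_ineq)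
      also have "\<dots> \<le> C * (t - s) * \<bar>y r\<bar> + C * (G t - G s)"
        using p1 p2 C r st by (intro add_mono mult_mono) auto
      finally show "norm (\<phi> t * y r + \<phi>' r * x s - g r) \<le> C * (t - s) * \<bar>y r\<bar> + C * (G t - G s)" .
    qed (use h k in \<open>auto simp: has_integral_iff\<close>)
    then show ?thesis using h k by (simp add: has_integral_iff)
  qed
  \<comment> \<open>The difference quotient of F at s is at most 2 C \<bar>G t - G s\<bar>, and G is
    continuous. So F is differentiable with derivative 0 even at points where x is not
    differentiable.\<close>
  have "\<exists>c. \<forall>t\<in>{0..T}. F t = c"
  proof (rule has_field_derivative_zero_constant)
    fix s assume s: "s \<in> {0..T}"
    have "((\<lambda>t. (F t - F s) / (t - s)) \<longlongrightarrow> 0) (at s within {0..T})"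
    proof (rule Lim_null_comparison)
      show "\<forall>\<^sub>F t in at s within {0..T}. norm ((F t - F s) / (t - s)) \<le> 2 * C * \<bar>G t - G s\<bar>"
        unfolding eventually_at_filter
      proof (intro always_eventually allI impI)
        fix t assume t: "t \<noteq> s" "t \<in> {0..T}"
        have "\<bar>F t - F s\<bar> \<le> 2 * C * \<bar>t - s\<bar> * \<bar>G t - G s\<bar>"
        proof (cases "s \<le> t")
          case True
          have "G t - G s \<ge> 0"
            using True s t by (subst G_diff[symmetric]) (auto intro!: Henstock_Kurzweil_Integration.integral_nonneg yabs_int)
          then show ?thesis using F_bound[of s t] True s t by auto
        next
          case False
          have "G s - G t \<ge> 0"
            using False s t by (subst G_diff[symmetric]) (auto intro!: Henstock_Kurzweil_Integration.integral_nonneg yabs_int)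
          then show ?thesis using F_bound[of t s] False s t by (auto simp: abs_minus_commute)
        qed
        then show "norm ((F t - F s) / (t - s)) \<le> 2 * C * \<bar>G t - G s\<bar>"
          using t by (simp add: abs_divide pos_divide_le_eq mult_ac)
      qed
      have "(G \<longlongrightarrow> G s) (at s within {0..T})"
        using G_cont s by (simp add: continuous_on_def)
      then have "((\<lambda>t. 2 * C * \<bar>G t - G s\<bar>) \<longlongrightarrow> 2 * C * \<bar>G s - G s\<bar>) (at s within {0..T})"
        by (intro tendsto_intros)
      then show "((\<lambda>t. 2 * C * \<bar>G t - G s\<bar>) \<longlongrightarrow> 0) (at s within {0..T})" by simp
    qed
    then show "(F has_field_derivative 0) (at s within {0..T})"
      by (simp add: has_field_derivative_iff)
  qed simp
  then have "F T = F 0" using T by auto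
  then show ?thesis
    using g_int0 by (simp add: F_def has_integral_iff g_def[abs_def])
qed

text \<open>The indicator of a bounded interval is square integrable, and the product of two square
  integrable functions is integrable.\<close>

lemma L2_absolutely_integrable_on:
  fixes y :: "real \<Rightarrow> real"
  assumes "y \<in> L2"
  shows "y absolutely_integrable_on {0..T}"
proof -
  have "(indicator {0..T} :: real \<Rightarrow> real) \<in> L2"
  proof -
    have "integrable lebesgue (indicator {0..T} :: real \<Rightarrow> real)"
      by (rule integrable_real_indicator) (auto simp: emeasure_lborel_Icc_eq)
    then have "integrable halfline (indicator {0..T} :: real \<Rightarrow> real)"
      by (subst integrable_restrict_space) (auto intro!: integrable_mult_indicator[where 'b = real, simplified])
    moreover have "(\<lambda>t. indicator {0..T} t \<bullet> (indicator {0..T} t :: real)) = (indicator {0..T} :: real \<Rightarrow> real)"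
      by (auto simp: indicator_def)
    ultimately show ?thesis
      unfolding L2_def by (simp only: mem_Collect_eq borel_measurable_integrable simp_thms)
  qed
  from L2_integrable_mult[OF this assms]
  have "integrable lebesgue (\<lambda>t. indicator {0..} t *\<^sub>R (indicator {0..T} t * y t))"
    by (subst (asm) integrable_restrict_space) auto
  moreover have "(\<lambda>t. indicator {0..} t *\<^sub>R (indicator {0..T} t * y t)) = (\<lambda>t. indicator {0..T} t *\<^sub>R y t)"
    by (auto simp: indicator_def)
  ultimately show ?thesis by (simp only: set_integrable_def)
qed

lemma has_integral_cart_component:
  fixes f :: "real \<Rightarrow> real^'n"
  assumes "(f has_integral y) S"
  shows "((\<lambda>t. f t $ i) has_integral (y $ i)) S"
proof -
  have "((\<lambda>t. f t \<bullet> axis i 1) has_integral (y \<bullet> axis i 1)) S"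
    using assms unfolding has_integral_componentwise_iff[of f] by (auto simp: Basis_vec_def)
  then show ?thesis by (simp add: inner_axis)
qed

lemma has_vector_derivative_cartI:
  fixes f :: "real \<Rightarrow> real^'n"
  assumes "\<And>i. ((\<lambda>t. f t $ i) has_real_derivative f' $ i) (at t within S)"
  shows "(f has_vector_derivative f') (at t within S)"
proof -
  have "((\<lambda>t. f t \<bullet> b) has_derivative (\<lambda>h. (h *\<^sub>R f') \<bullet> b)) (at t within S)" if b: "b \<in> Basis" for b
  proof -
    obtain i where "b = axis i 1"
      using b by (auto simp: Basis_vec_def)
    then show ?thesis
      using assms[of i] by (simp add: inner_axis has_field_derivative_def mult.commute mult_commute_abs)
  qed
  then show ?thesis
    unfolding has_vector_derivative_def by (subst has_derivative_componentwise_within) blast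
qed

text \<open>Only the case \<open>s = k + 1\<close> of the differential equation is used; it makes the coefficient
  matrix \<open>D\<close> lower triangular and independent of \<open>s\<close>.\<close>

lemma exp_stable_basis_coeffs:
  assumes "exp_stable_basis \<tau>"
  obtains D :: "nat \<Rightarrow> nat \<Rightarrow> real" where
    "\<And>k l. k < l \<Longrightarrow> D k l = 0"
    "\<And>k t. t \<ge> 0 \<Longrightarrow> (\<tau> k has_real_derivative (\<Sum>l\<le>k. D k l * \<tau> l t)) (at t within {0..})"
proof -
  have "\<exists>d. \<forall>t\<ge>0. (\<tau> k has_real_derivative (\<Sum>l\<le>k. d l * \<tau> l t)) (at t within {0..})" for k
  proof -
    obtain M where M: "M \<in> carrier_mat (Suc k) (Suc k)"
      and d: "\<forall>t\<ge>0. \<forall>j<Suc k. (\<tau> j has_real_derivative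
        Matrix.vec_index (M *\<^sub>v tau_vec \<tau> (Suc k) t) j) (at t within {0..})"
      using assms unfolding exp_stable_basis_def by force
    have "Matrix.vec_index (M *\<^sub>v tau_vec \<tau> (Suc k) t) k = (\<Sum>l\<le>k. M $$ (k, l) * \<tau> l t)" for t
      using M by (auto simp: scalar_prod_def tau_vec_def atLeast0LessThan lessThan_Suc_atMost)
    moreover have "(\<tau> k has_real_derivative Matrix.vec_index (M *\<^sub>v tau_vec \<tau> (Suc k) t) k) (at t within {0..})"
      if "t \<ge> 0" for t
      using d that by blast
    ultimately have "\<forall>t\<ge>0. (\<tau> k has_real_derivative (\<Sum>l\<le>k. M $$ (k, l) * \<tau> l t)) (at t within {0..})"
      by simp
    then show ?thesis by (rule exI[of _ "\<lambda>l. M $$ (k, l)"])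
  qed
  then obtain d where d: "\<And>k t. t \<ge> 0 \<Longrightarrow>
      (\<tau> k has_real_derivative (\<Sum>l\<le>k. d k l * \<tau> l t)) (at t within {0..})"
    by metis
  show thesis
    by (rule that[of "\<lambda>k l. if l \<le> k then d k l else 0"]) (use d in auto)
qed

subsection \<open>Coefficients with respect to the basis\<close>

lemma lookup_scaleR: "Poly_Mapping.lookup (r *\<^sub>R \<eta>) p = r *\<^sub>R Poly_Mapping.lookup \<eta> p"
proof -
  have "finite {p. r *\<^sub>R Poly_Mapping.lookup \<eta> p \<noteq> 0}"
    by (rule finite_subset[OF _ finite_keys[of \<eta>]]) (auto simp: in_keys_iff)
  then show ?thesis
    by (simp add: scaleR_poly_mapping_def Abs_poly_mapping_inverse)
qed

lemma param_eqI:
  assumes "\<eta> \<in> param_space s" "\<eta>' \<in> param_space s"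
    and "\<And>i k. k < s \<Longrightarrow> Poly_Mapping.lookup \<eta> (i, k) = Poly_Mapping.lookup \<eta>' (i, k)"
  shows "\<eta> = \<eta>'"
proof (rule poly_mapping_eqI)
  fix p :: "'a \<times> nat"
  obtain i k where p: "p = (i, k)" by (cases p)
  show "Poly_Mapping.lookup \<eta> p = Poly_Mapping.lookup \<eta>' p"
  proof (cases "k < s")
    case False
    then have "p \<notin> Poly_Mapping.keys \<eta>" "p \<notin> Poly_Mapping.keys \<eta>'"
      using assms(1,2) p by (auto simp: param_space_def)
    then show ?thesis by (simp add: in_keys_iff)
  qed (use assms(3) p in auto)
qed

lemma lookup_param_space: "\<eta> \<in> param_space s \<Longrightarrow> s \<le> k \<Longrightarrow> Poly_Mapping.lookup \<eta> (i, k) = 0"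
  by (force simp: param_space_def in_keys_iff)

lemma param_space_mono: "s \<le> r \<Longrightarrow> param_space s \<subseteq> param_space r"
  by (force simp: param_space_def)

text \<open>The metric of \<open>poly_mapping\<close> adds up coordinate distances, and inside one
  \<open>param_space s\<close> only finitely many coordinates can differ. Closedness of the
  constraint sets refers to this metric, whereas limits are found coordinatewise.\<close>

lemma param_space_tendsto:
  fixes \<eta> :: "nat \<Rightarrow> ('n::finite) param"
  assumes "\<And>n. \<eta> n \<in> param_space s" "\<zeta> \<in> param_space s"
    and lim: "\<And>p. (\<lambda>n. Poly_Mapping.lookup (\<eta> n) p) \<longlonglongrightarrow> Poly_Mapping.lookup \<zeta> p"
  shows "\<eta> \<longlonglongrightarrow> \<zeta>"
proof -
  have "dist (\<eta> n) \<zeta> = (\<Sum>p\<in>UNIV \<times> {..<s}. dist (Poly_Mapping.lookup (\<eta> n) p) (Poly_Mapping.lookup \<zeta> p))" for n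
    unfolding dist_poly_mapping_def
    using assms(1)[of n] assms(2)
    by (intro sum.mono_neutral_left) (auto simp: param_space_def in_keys_iff)
  moreover have "(\<lambda>n. \<Sum>p\<in>UNIV \<times> {..<s}. dist (Poly_Mapping.lookup (\<eta> n) p) (Poly_Mapping.lookup \<zeta> p)) \<longlonglongrightarrow> 0"
    by (intro tendsto_null_sum) (simp add: tendsto_dist_iff[symmetric] lim)
  ultimately show ?thesis
    by (simp add: tendsto_dist_iff[of \<eta>])
qed

lemma ereal_sandwich_real:
  fixes x :: ereal
  shows "0 \<le> x \<Longrightarrow> x \<le> ereal b \<Longrightarrow> \<exists>r\<ge>0. x = ereal r"
  by (cases x) auto

locale L2_basis =
  fixes \<tau> :: "nat \<Rightarrow> real \<Rightarrow> real" and D :: "nat \<Rightarrow> nat \<Rightarrow> real"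
  assumes orthonormal: "orthonormal_L2 \<tau>"
    and D_upper: "\<And>k l. k < l \<Longrightarrow> D k l = 0"
    and has_derivative_le: "\<And>k t. t \<ge> 0 \<Longrightarrow>
      (\<tau> k has_real_derivative (\<Sum>l\<le>k. D k l * \<tau> l t)) (at t within {0..})"
begin

definition expansion :: "(nat \<Rightarrow> real) \<Rightarrow> nat \<Rightarrow> real \<Rightarrow> real" where
  "expansion c s t = (\<Sum>k<s. c k * \<tau> k t)"

definition d\<tau> :: "nat \<Rightarrow> real \<Rightarrow> real" where
  "d\<tau> k t = expansion (D k) (Suc k) t"

text \<open>Triangularity of \<open>D\<close> allows padding with zeros, so the derivatives of all
  basis functions below s can be written with a common number of terms.\<close>

lemma d\<tau>_eq: "k < s \<Longrightarrow> d\<tau> k t = expansion (D k) s t"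
  unfolding d\<tau>_def expansion_def
  by (rule sum.mono_neutral_left) (auto simp: D_upper)

lemma \<tau>_has_derivative: "t \<ge> 0 \<Longrightarrow> (\<tau> k has_real_derivative d\<tau> k t) (at t within {0..})"
  using has_derivative_le[of t k] by (simp add: d\<tau>_def expansion_def lessThan_Suc_atMost)

lemma \<tau>_L2: "\<tau> k \<in> L2"
  using orthonormal by (simp add: orthonormal_L2_def)

lemma \<tau>_\<tau>: "(LINT t|halfline. \<tau> j t * \<tau> k t) = (if j = k then 1 else 0)"
  using orthonormal by (simp add: orthonormal_L2_def)

lemma expansion_L2: "expansion c s \<in> L2"
  unfolding expansion_def[abs_def]
  using L2_scaleR[OF \<tau>_L2] by (intro L2_sum) simp

lemma d\<tau>_L2: "d\<tau> k \<in> L2"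
  unfolding d\<tau>_def[abs_def] by (rule expansion_L2)

lemma integral_mult_expansion:
  assumes "f \<in> L2"
  shows "(LINT t|halfline. f t * expansion c s t) = (\<Sum>k<s. c k * (LINT t|halfline. \<tau> k t * f t))"
proof -
  have "(LINT t|halfline. f t * expansion c s t) = (LINT t|halfline. (\<Sum>k<s. c k * (\<tau> k t * f t)))"
    by (simp add: expansion_def sum_distrib_left mult_ac)
  also have "\<dots> = (\<Sum>k<s. LINT t|halfline. c k * (\<tau> k t * f t))"
    by (intro Bochner_Integration.integral_sum integrable_mult_right L2_integrable_mult \<tau>_L2 assms)
  finally show ?thesis by simp
qed

lemma \<tau>_expansion: "(LINT t|halfline. \<tau> j t * expansion c s t) = (if j < s then c j else 0)"
  by (subst integral_mult_expansion[OF \<tau>_L2]) (simp add: \<tau>_\<tau> if_distrib cong: if_cong)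

lemma expansion_expansion:
  "(LINT t|halfline. expansion c s t * expansion c s t) = (\<Sum>k<s. (c k)\<^sup>2)"
  by (subst integral_mult_expansion[OF expansion_L2]) (simp add: \<tau>_expansion power2_eq_square)

lemma Bessel:
  assumes "f \<in> L2"
  shows "(\<Sum>k<s. (LINT t|halfline. \<tau> k t * f t)\<^sup>2) \<le> (LINT t|halfline. f t * f t)"
proof -
  define c where "c k = (LINT t|halfline. \<tau> k t * f t)" for k
  have i: "integrable halfline (\<lambda>t. f t * f t)" "integrable halfline (\<lambda>t. f t * expansion c s t)"
    "integrable halfline (\<lambda>t. expansion c s t * expansion c s t)"
    by (intro L2_integrable_mult expansion_L2 assms)+
  have "0 \<le> (LINT t|halfline. (f t - expansion c s t)\<^sup>2)" by simp
  also have "\<dots> = (LINT t|halfline. f t * f t - 2 * (f t * expansion c s t) + expansion c s t * expansion c s t)"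
    by (simp add: power2_eq_square algebra_simps)
  also have "\<dots> = (LINT t|halfline. f t * f t) - 2 * (\<Sum>k<s. (c k)\<^sup>2) + (\<Sum>k<s. (c k)\<^sup>2)"
    using i by (simp add: expansion_expansion integral_mult_expansion[OF assms] c_def[symmetric] power2_eq_square)
  finally show ?thesis by (simp add: c_def)
qed

text \<open>The derivative moves from f to \<tau> k with no contribution at infinity. Re-expanding
  the derivative of \<tau> k leaves only the coefficients of f with index at most k.\<close>

lemma integration_by_parts:
  assumes "f \<in> L2" "g \<in> L2" and prim: "\<And>t. t \<ge> 0 \<Longrightarrow> (g has_integral (f t - f 0)) {0..t}"
  shows "(LINT t|halfline. \<tau> k t * g t) + (\<Sum>l\<le>k. D k l * (LINT t|halfline. \<tau> l t * f t)) = - \<tau> k 0 * f 0"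
proof -
  have i: "integrable halfline (\<lambda>t. \<tau> k t * f t)" "integrable halfline (\<lambda>t. \<tau> k t * g t)"
    "integrable halfline (\<lambda>t. d\<tau> k t * f t)"
    by (intro L2_integrable_mult d\<tau>_L2 \<tau>_L2 assms)+
  have "(LINT t|halfline. \<tau> k t * g t + d\<tau> k t * f t) = - (\<tau> k 0 * f 0)"
  proof (rule halfline_integral_derivative[OF i(1)])
    show "integrable halfline (\<lambda>t. \<tau> k t * g t + d\<tau> k t * f t)"
      using i by simp
    fix T :: real assume T: "T \<ge> 0"
    have \<tau>': "(\<tau> j has_real_derivative d\<tau> j t) (at t within {0..T})" if "t \<in> {0..T}" for j t
      using that by (intro DERIV_subset[OF \<tau>_has_derivative]) auto
    have "continuous_on {0..T} (\<tau> j)" for j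
      using \<tau>' by (rule DERIV_continuous_on)
    \<comment> \<open>The derivative is itself a combination of basis functions, which are
      differentiable and hence continuous.\<close>
    then have "continuous_on {0..T} (d\<tau> k)"
      unfolding d\<tau>_def[abs_def] expansion_def by (intro continuous_intros)
    then show "((\<lambda>t. \<tau> k t * g t + d\<tau> k t * f t) has_integral \<tau> k T * f T - \<tau> k 0 * f 0) {0..T}"
      using prim by (intro integration_by_parts_indefinite_integral T \<tau>' L2_absolutely_integrable_on assms) auto
  qed
  moreover have "(LINT t|halfline. d\<tau> k t * f t) = (\<Sum>l\<le>k. D k l * (LINT t|halfline. \<tau> l t * f t))"
    using integral_mult_expansion[OF assms(1), of "D k" "Suc k"]
    by (simp add: d\<tau>_def mult.commute lessThan_Suc_atMost)
  ultimately show ?thesis using i by simp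
qed

text \<open>Integration by parts with f = \<tau> l: by orthonormality the two integrals are the
  entries \<open>D l k\<close> and \<open>D k l\<close>, and the boundary term is the product of the
  values at 0.\<close>

lemma D_transpose: "D l k = - \<tau> k 0 * \<tau> l 0 - D k l"
proof -
  have "(d\<tau> l has_integral (\<tau> l t - \<tau> l 0)) {0..t}" if "t \<ge> 0" for t
  proof (rule fundamental_theorem_of_calculus[OF that])
    fix r assume "r \<in> {0..t}"
    then have "(\<tau> l has_real_derivative d\<tau> l r) (at r within {0..t})"
      by (intro DERIV_subset[OF \<tau>_has_derivative]) auto
    then show "(\<tau> l has_vector_derivative d\<tau> l r) (at r within {0..t})"
      by (simp add: has_real_derivative_iff_has_vector_derivative)
  qed
  from integration_by_parts[OF \<tau>_L2 d\<tau>_L2 this, of k]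
  show ?thesis
    using D_upper[of l k] D_upper[of k l]
    by (cases "l \<le> k"; cases "k \<le> l") (auto simp: d\<tau>_def \<tau>_expansion \<tau>_\<tau> if_distrib cong: if_cong)
qed

lemma traj_comp: "traj \<tau> s \<eta> t $ i = expansion (\<lambda>k. Poly_Mapping.lookup \<eta> (i, k)) s t"
  by (simp add: traj_def expansion_def mult.commute)

lemma traj_L2: "traj \<tau> s \<eta> \<in> L2"
  by (rule L2_vec) (simp add: traj_comp expansion_L2)

lemma L2_norm_traj: "(L2_norm (traj \<tau> s \<eta>))\<^sup>2 = (\<Sum>i\<in>UNIV. \<Sum>k<s. (Poly_Mapping.lookup \<eta> (i, k))\<^sup>2)"
  by (simp add: L2_norm_square_cart[OF traj_L2] traj_comp expansion_expansion)

text \<open>Orthonormality makes the map from parameters to trajectories an isometry; all later cost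
  comparisons are done on these finite sums.\<close>

lemma param_cost_eq:
  "param_cost \<tau> s \<eta>x \<eta>u = 1/2 * (\<Sum>i\<in>UNIV. \<Sum>k<s. (Poly_Mapping.lookup \<eta>x (i, k))\<^sup>2)
    + 1/2 * (\<Sum>i\<in>UNIV. \<Sum>k<s. (Poly_Mapping.lookup \<eta>u (i, k))\<^sup>2)"
  by (simp add: param_cost_def cost_def L2_norm_traj)

lemma lookup_proj_step:
  "Poly_Mapping.lookup (proj_step \<tau> s \<eta>) (i, k) = (if k < s then Poly_Mapping.lookup \<eta> (i, k) else 0)"
  by (simp add: proj_step_def proj_def lookup_mk_param traj_comp \<tau>_expansion)

lemma traj_mono:
  assumes "\<eta> \<in> param_space s" "s \<le> r"
  shows "traj \<tau> r \<eta> = traj \<tau> s \<eta>"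
  unfolding traj_def using assms
  by (intro ext arg_cong[where f = vec_lambda] sum.mono_neutral_right) (auto simp: lookup_param_space)

text \<open>The parameter spaces are nested, and the padded coefficients contribute zero terms.
  Uniqueness in the definite description comes from recovering each coefficient by integration
  against \<tau> k.\<close>

lemma incl_eq:
  assumes "\<eta> \<in> param_space s"
  shows "incl \<tau> s \<eta> = \<eta>"
  unfolding incl_def
proof (rule the_equality)
  show "\<eta> \<in> param_space (Suc s) \<and> (\<forall>t\<ge>0. traj \<tau> s \<eta> t = traj \<tau> (Suc s) \<eta> t)"
    using assms param_space_mono[of s "Suc s"] traj_mono[OF assms, of "Suc s"] by auto
next
  fix \<eta>' assume \<eta>': "\<eta>' \<in> param_space (Suc s) \<and> (\<forall>t\<ge>0. traj \<tau> s \<eta> t = traj \<tau> (Suc s) \<eta>' t)"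
  show "\<eta>' = \<eta>"
  proof (rule param_eqI)
    show "\<eta>' \<in> param_space (Suc s)" "\<eta> \<in> param_space (Suc s)"
      using assms param_space_mono[of s "Suc s"] \<eta>' by auto
    fix i k assume k: "k < Suc s"
    have "(LINT t|halfline. \<tau> k t * traj \<tau> (Suc s) \<eta>' t $ i) = (LINT t|halfline. \<tau> k t * traj \<tau> (Suc s) \<eta> t $ i)"
      using \<eta>' traj_mono[OF assms, of "Suc s"]
      by (intro Bochner_Integration.integral_cong) auto
    then show "Poly_Mapping.lookup \<eta>' (i, k) = Poly_Mapping.lookup \<eta> (i, k)"
      using k by (simp add: traj_comp \<tau>_expansion)
  qed
qed

section \<open>The constraints as linear equations for the coefficients\<close>

text \<open>Coordinate k of component i of A x + B u - x'. Row l of \<open>D\<close> holds the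
  coordinates of the derivative of \<tau> l, so \<open>D\<close> enters transposed here.\<close>

definition residual_coeff ::
    "real^'n^'n \<Rightarrow> real^'m^'n \<Rightarrow> nat \<Rightarrow> 'n param \<Rightarrow> 'm param \<Rightarrow> 'n \<Rightarrow> nat \<Rightarrow> real" where
  "residual_coeff A B s \<eta>x \<eta>u i k =
     (\<Sum>j\<in>UNIV. A $ i $ j * Poly_Mapping.lookup \<eta>x (j, k))
     + (\<Sum>j\<in>UNIV. B $ i $ j * Poly_Mapping.lookup \<eta>u (j, k))
     - (\<Sum>l<s. Poly_Mapping.lookup \<eta>x (i, l) * D l k)"

lemma traj_has_vector_derivative:
  fixes \<eta> :: "'n::finite param"
  assumes "t \<ge> 0"
  shows "(traj \<tau> s \<eta> has_vector_derivative (\<chi> i. \<Sum>k<s. Poly_Mapping.lookup \<eta> (i, k) * d\<tau> k t)) (at t within {0..})"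
proof (rule has_vector_derivative_cartI)
  fix i
  have "((\<lambda>t. \<Sum>k<s. Poly_Mapping.lookup \<eta> (i, k) * \<tau> k t) has_real_derivative
      (\<Sum>k<s. Poly_Mapping.lookup \<eta> (i, k) * d\<tau> k t)) (at t within {0..})"
    by (intro DERIV_sum DERIV_cmult \<tau>_has_derivative assms)
  then show "((\<lambda>t. traj \<tau> s \<eta> t $ i) has_real_derivative
      (\<chi> i. \<Sum>k<s. Poly_Mapping.lookup \<eta> (i, k) * d\<tau> k t) $ i) (at t within {0..})"
    by (simp add: traj_comp expansion_def)
qed

lemma residual_eq:
  assumes "t \<ge> 0"
  shows "residual A B \<tau> s \<eta>x \<eta>u t $ i = expansion (residual_coeff A B s \<eta>x \<eta>u i) s t"
proof -
  \<comment> \<open>\<open>vector_derivative\<close> is a choice, determined only at limit points of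
    the half line; t = 0 is one, with a one-sided derivative.\<close>
  have "t islimpt {t..t + 1}" by (simp add: islimpt_Icc)
  then have "t islimpt {0..}" by (rule islimpt_subset) (use assms in auto)
  then have "at t within {0..} \<noteq> bot"
    by (simp add: trivial_limit_within)
  then have "vector_derivative (traj \<tau> s \<eta>x) (at t within {0..})
      = (\<chi> i. \<Sum>k<s. Poly_Mapping.lookup \<eta>x (i, k) * d\<tau> k t)"
    by (rule vector_derivative_within[OF _ traj_has_vector_derivative[OF assms]])
  then have "residual A B \<tau> s \<eta>x \<eta>u t $ i = (\<Sum>j\<in>UNIV. A $ i $ j * traj \<tau> s \<eta>x t $ j)
      + (\<Sum>j\<in>UNIV. B $ i $ j * traj \<tau> s \<eta>u t $ j) - (\<Sum>l<s. Poly_Mapping.lookup \<eta>x (i, l) * expansion (D l) s t)"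
    by (simp add: residual_def matrix_vector_mult_def d\<tau>_eq)
  also have "(\<Sum>j\<in>UNIV. A $ i $ j * traj \<tau> s \<eta>x t $ j)
      = (\<Sum>k<s. (\<Sum>j\<in>UNIV. A $ i $ j * Poly_Mapping.lookup \<eta>x (j, k)) * \<tau> k t)"
    unfolding traj_comp expansion_def sum_distrib_left sum_distrib_right
    by (subst sum.swap) (simp add: mult_ac)
  also have "(\<Sum>j\<in>UNIV. B $ i $ j * traj \<tau> s \<eta>u t $ j)
      = (\<Sum>k<s. (\<Sum>j\<in>UNIV. B $ i $ j * Poly_Mapping.lookup \<eta>u (j, k)) * \<tau> k t)"
    unfolding traj_comp expansion_def sum_distrib_left sum_distrib_right
    by (subst sum.swap) (simp add: mult_ac)
  also have "(\<Sum>l<s. Poly_Mapping.lookup \<eta>x (i, l) * expansion (D l) s t)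
      = (\<Sum>k<s. (\<Sum>l<s. Poly_Mapping.lookup \<eta>x (i, l) * D l k) * \<tau> k t)"
    unfolding expansion_def sum_distrib_left sum_distrib_right
    by (subst sum.swap) (simp add: mult_ac)
  finally show ?thesis
    by (simp add: expansion_def residual_coeff_def sum.distrib sum_subtractf algebra_simps)
qed

lemma lookup_proj_residual:
  "Poly_Mapping.lookup (proj \<tau> s (residual A B \<tau> s \<eta>x \<eta>u)) (i, k) =
    (if k < s then residual_coeff A B s \<eta>x \<eta>u i k else 0)"
proof -
  have "(LINT t|halfline. \<tau> k t * residual A B \<tau> s \<eta>x \<eta>u t $ i)
      = (LINT t|halfline. \<tau> k t * expansion (residual_coeff A B s \<eta>x \<eta>u i) s t)"
    by (intro Bochner_Integration.integral_cong) (auto simp: residual_eq)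
  then show ?thesis by (simp add: proj_def lookup_mk_param \<tau>_expansion)
qed

lemma proj_residual_eq_0_iff:
  "proj \<tau> s (residual A B \<tau> s \<eta>x \<eta>u) = 0 \<longleftrightarrow> (\<forall>i. \<forall>k<s. residual_coeff A B s \<eta>x \<eta>u i k = 0)"
proof
  assume "proj \<tau> s (residual A B \<tau> s \<eta>x \<eta>u) = 0"
  then show "\<forall>i. \<forall>k<s. residual_coeff A B s \<eta>x \<eta>u i k = 0"
    using lookup_proj_residual[of s A B \<eta>x \<eta>u] by (metis lookup_zero)
next
  assume "\<forall>i. \<forall>k<s. residual_coeff A B s \<eta>x \<eta>u i k = 0"
  then show "proj \<tau> s (residual A B \<tau> s \<eta>x \<eta>u) = 0"
    by (intro poly_mapping_eqI) (auto simp: lookup_proj_residual)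
qed

lemma residual_eq_0:
  assumes "proj \<tau> s (residual A B \<tau> s \<eta>x \<eta>u) = 0" "t \<ge> 0"
  shows "residual A B \<tau> s \<eta>x \<eta>u t = 0"
  using assms
  by (simp add: Finite_Cartesian_Product.vec_eq_iff residual_eq proj_residual_eq_0_iff expansion_def)

text \<open>Rewriting \<open>D l k\<close> by \<open>D_transpose\<close> produces \<tau> k 0 times
  the initial value of the trajectory, which cancels against the boundary term and leaves \<tau> k 0
  times \<open>x0\<close>. By triangularity the remaining sum stops at k. So the equation for k no
  longer mentions s, and it is the one that \<open>integration_by_parts\<close> yields for solutions
  of the full problem.\<close>

lemma feasible2_iff:
  "(\<eta>x, \<eta>u) \<in> feasible2 A B x0 \<tau> XT UT s \<longleftrightarrow> \<eta>x \<in> XT s \<and> \<eta>u \<in> UT s \<and>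
    (\<forall>i. \<forall>k<s. (\<Sum>j\<in>UNIV. A $ i $ j * Poly_Mapping.lookup \<eta>x (j, k))
      + (\<Sum>j\<in>UNIV. B $ i $ j * Poly_Mapping.lookup \<eta>u (j, k))
      + (\<Sum>l\<le>k. D k l * Poly_Mapping.lookup \<eta>x (i, l)) + \<tau> k 0 * x0 $ i = 0)"
proof -
  let ?p = "proj \<tau> s (residual A B \<tau> s \<eta>x \<eta>u) - kron_tau \<tau> s 0 (traj \<tau> s \<eta>x 0 - x0)"
  have lookup: "Poly_Mapping.lookup ?p (i, k) = (if k < s then
      (\<Sum>j\<in>UNIV. A $ i $ j * Poly_Mapping.lookup \<eta>x (j, k))
      + (\<Sum>j\<in>UNIV. B $ i $ j * Poly_Mapping.lookup \<eta>u (j, k))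
      + (\<Sum>l\<le>k. D k l * Poly_Mapping.lookup \<eta>x (i, l)) + \<tau> k 0 * x0 $ i else 0)" for i k
  proof (cases "k < s")
    case True
    have "(\<Sum>l<s. Poly_Mapping.lookup \<eta>x (i, l) * D l k)
        = (\<Sum>l<s. - (\<tau> k 0 * (Poly_Mapping.lookup \<eta>x (i, l) * \<tau> l 0)) - D k l * Poly_Mapping.lookup \<eta>x (i, l))"
      by (intro sum.cong refl) (subst D_transpose, simp add: algebra_simps)
    also have "\<dots> = - (\<tau> k 0 * traj \<tau> s \<eta>x 0 $ i) - (\<Sum>l<s. D k l * Poly_Mapping.lookup \<eta>x (i, l))"
      by (simp add: sum_subtractf sum_negf traj_comp expansion_def sum_distrib_left)
    also have "(\<Sum>l<s. D k l * Poly_Mapping.lookup \<eta>x (i, l)) = (\<Sum>l\<le>k. D k l * Poly_Mapping.lookup \<eta>x (i, l))"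
      using True by (intro sum.mono_neutral_right) (auto simp: D_upper)
    finally show ?thesis using True
      by (simp add: lookup_minus lookup_proj_residual kron_tau_def lookup_mk_param residual_coeff_def algebra_simps)
  qed (simp add: lookup_minus lookup_proj_residual kron_tau_def lookup_mk_param)
  have "?p = 0 \<longleftrightarrow> (\<forall>i k. Poly_Mapping.lookup ?p (i, k) = 0)"
    using poly_mapping_eqI[of ?p 0] by (metis lookup_zero surj_pair)
  then show ?thesis
    unfolding feasible2_def lookup by auto
qed

subsection \<open>The finite-dimensional problems\<close>

lemma param_cost_nonneg: "0 \<le> param_cost \<tau> s \<eta>x \<eta>u"
  unfolding param_cost_eq by (intro add_nonneg_nonneg mult_nonneg_nonneg sum_nonneg) auto

text \<open>Stated with the midpoint in place of the sum, because convexity keeps the midpoint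
  feasible; this accounts for the factor 4.\<close>

lemma param_cost_parallelogram:
  "param_cost \<tau> s (\<eta>x - \<eta>x') (\<eta>u - \<eta>u')
      + 4 * param_cost \<tau> s ((1/2) *\<^sub>R \<eta>x + (1/2) *\<^sub>R \<eta>x') ((1/2) *\<^sub>R \<eta>u + (1/2) *\<^sub>R \<eta>u')
    = 2 * param_cost \<tau> s \<eta>x \<eta>u + 2 * param_cost \<tau> s \<eta>x' \<eta>u'"
proof -
  have *: "(a - b)\<^sup>2 + 4 * (a / 2 + b / 2)\<^sup>2 = 2 * a\<^sup>2 + 2 * b\<^sup>2" for a b :: real
    by (simp add: power2_eq_square field_simps)
  have "(\<Sum>i\<in>UNIV. \<Sum>k<s. (Poly_Mapping.lookup (\<zeta> - \<zeta>') (i, k))\<^sup>2)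
      + 4 * (\<Sum>i\<in>UNIV. \<Sum>k<s. (Poly_Mapping.lookup ((1/2) *\<^sub>R \<zeta> + (1/2) *\<^sub>R \<zeta>') (i, k))\<^sup>2)
      = 2 * (\<Sum>i\<in>UNIV. \<Sum>k<s. (Poly_Mapping.lookup \<zeta> (i, k))\<^sup>2)
      + 2 * (\<Sum>i\<in>UNIV. \<Sum>k<s. (Poly_Mapping.lookup \<zeta>' (i, k))\<^sup>2)" for \<zeta> \<zeta>' :: "('q::finite) param"
    by (simp add: sum_distrib_left sum.distrib[symmetric] lookup_minus lookup_add lookup_scaleR *)
  note sums = this[of \<eta>x \<eta>x'] this[of \<eta>u \<eta>u']
  have combine: "1/2 * a + 1/2 * b + 4 * (1/2 * a' + 1/2 * b') = 2 * (1/2 * c + 1/2 * d) + 2 * (1/2 * c' + 1/2 * d')"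
    if "a + 4 * a' = 2 * c + 2 * c'" "b + 4 * b' = 2 * d + 2 * d'" for a a' b b' c c' d d' :: real
    using that by simp
  show ?thesis
    unfolding param_cost_eq by (rule combine[OF sums])
qed

text \<open>Makes differences of small cost small in every coordinate, as needed for uniqueness and
  for coordinatewise limits.\<close>

lemma lookup_square_le_param_cost:
  assumes "k < s"
  shows "(Poly_Mapping.lookup \<eta>x (i, k))\<^sup>2 \<le> 2 * param_cost \<tau> s \<eta>x \<eta>u"
    and "(Poly_Mapping.lookup \<eta>u (j, k))\<^sup>2 \<le> 2 * param_cost \<tau> s \<eta>x \<eta>u"
proof -
  have le: "(Poly_Mapping.lookup \<zeta> (i, k))\<^sup>2 \<le> (\<Sum>i\<in>UNIV. \<Sum>k<s. (Poly_Mapping.lookup \<zeta> (i, k))\<^sup>2)"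
    for i and \<zeta> :: "('q::finite) param"
  proof -
    have "(Poly_Mapping.lookup \<zeta> (i, k))\<^sup>2 \<le> (\<Sum>k<s. (Poly_Mapping.lookup \<zeta> (i, k))\<^sup>2)"
      using assms by (intro member_le_sum) auto
    also have "\<dots> \<le> (\<Sum>i\<in>UNIV. \<Sum>k<s. (Poly_Mapping.lookup \<zeta> (i, k))\<^sup>2)"
      by (rule member_le_sum) (auto intro: sum_nonneg)
    finally show ?thesis .
  qed
  have nonneg: "0 \<le> (\<Sum>i\<in>UNIV. \<Sum>k<s. (Poly_Mapping.lookup \<zeta> (i, k))\<^sup>2)" for \<zeta> :: "('q::finite) param"
    by (intro sum_nonneg) auto
  have combine: "a \<le> 2 * (1/2 * b + 1/2 * c)" "a \<le> 2 * (1/2 * c + 1/2 * b)" if "a \<le> b" "0 \<le> c" for a b c :: real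
    using that by simp_all
  show "(Poly_Mapping.lookup \<eta>x (i, k))\<^sup>2 \<le> 2 * param_cost \<tau> s \<eta>x \<eta>u"
    unfolding param_cost_eq by (rule combine(1)[OF le nonneg])
  show "(Poly_Mapping.lookup \<eta>u (j, k))\<^sup>2 \<le> 2 * param_cost \<tau> s \<eta>x \<eta>u"
    unfolding param_cost_eq by (rule combine(2)[OF le nonneg])
qed

lemma feasible1_iff:
  "(\<eta>x, \<eta>u) \<in> feasible1 A B x0 \<tau> XS US s \<longleftrightarrow> \<eta>x \<in> XS s \<and> \<eta>u \<in> US s \<and>
    (\<forall>i. \<forall>k<s. residual_coeff A B s \<eta>x \<eta>u i k = 0) \<and>
    (\<forall>i. (\<Sum>k<s. Poly_Mapping.lookup \<eta>x (i, k) * \<tau> k 0) = x0 $ i)"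
  by (auto simp: feasible1_def proj_residual_eq_0_iff Finite_Cartesian_Product.vec_eq_iff traj_comp expansion_def)

lemma feasible1_midpoint:
  assumes "convex (XS s)" "convex (US s)"
    and "(\<eta>x, \<eta>u) \<in> feasible1 A B x0 \<tau> XS US s" "(\<eta>x', \<eta>u') \<in> feasible1 A B x0 \<tau> XS US s"
  shows "((1/2) *\<^sub>R \<eta>x + (1/2) *\<^sub>R \<eta>x', (1/2) *\<^sub>R \<eta>u + (1/2) *\<^sub>R \<eta>u') \<in> feasible1 A B x0 \<tau> XS US s"
proof -
  have "residual_coeff A B s ((1/2) *\<^sub>R \<eta>x + (1/2) *\<^sub>R \<eta>x') ((1/2) *\<^sub>R \<eta>u + (1/2) *\<^sub>R \<eta>u') i k
      = (1/2) * residual_coeff A B s \<eta>x \<eta>u i k + (1/2) * residual_coeff A B s \<eta>x' \<eta>u' i k" for i k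
    by (simp add: residual_coeff_def lookup_add lookup_scaleR algebra_simps sum.distrib sum_distrib_left
        add_divide_distrib diff_divide_distrib sum_divide_distrib)
  moreover have "(\<Sum>k<s. Poly_Mapping.lookup ((1/2) *\<^sub>R \<eta>x + (1/2) *\<^sub>R \<eta>x') (i, k) * \<tau> k 0)
      = (1/2) * (\<Sum>k<s. Poly_Mapping.lookup \<eta>x (i, k) * \<tau> k 0)
      + (1/2) * (\<Sum>k<s. Poly_Mapping.lookup \<eta>x' (i, k) * \<tau> k 0)" for i
    unfolding sum_distrib_left sum.distrib[symmetric]
    by (simp add: lookup_add lookup_scaleR algebra_simps)
  moreover have "(1/2) *\<^sub>R \<eta>x + (1/2) *\<^sub>R \<eta>x' \<in> XS s" "(1/2) *\<^sub>R \<eta>u + (1/2) *\<^sub>R \<eta>u' \<in> US s"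
    using assms by (auto simp: feasible1_iff intro!: convexD)
  ultimately show ?thesis
    using assms(3,4) by (simp add: feasible1_iff)
qed

text \<open>The feasible midpoint costs at least j, so subtracting 4 j from 2 (j + e) + 2 (j + e')
  in the parallelogram identity leaves only the excesses.\<close>

lemma almost_minimizers1_close:
  assumes "convex (XS s)" "convex (US s)"
    and "(\<eta>x, \<eta>u) \<in> feasible1 A B x0 \<tau> XS US s" "(\<eta>x', \<eta>u') \<in> feasible1 A B x0 \<tau> XS US s"
    and J: "ereal j \<le> J1 A B x0 \<tau> XS US s"
    and "param_cost \<tau> s \<eta>x \<eta>u \<le> j + e" "param_cost \<tau> s \<eta>x' \<eta>u' \<le> j + e'"
  shows "param_cost \<tau> s (\<eta>x - \<eta>x') (\<eta>u - \<eta>u') \<le> 2 * e + 2 * e'"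
proof -
  have "ereal j \<le> ereal (param_cost \<tau> s ((1/2) *\<^sub>R \<eta>x + (1/2) *\<^sub>R \<eta>x') ((1/2) *\<^sub>R \<eta>u + (1/2) *\<^sub>R \<eta>u'))"
    using J unfolding J1_def
    by (rule order_trans[OF _ INF_lower2[OF feasible1_midpoint[OF assms(1-4)]]]) simp
  then show ?thesis
    using assms(6,7) param_cost_parallelogram[of s \<eta>x \<eta>x' \<eta>u \<eta>u'] by simp
qed

lemma minimizers1_unique:
  assumes "convex (XS s)" "convex (US s)" "XS s \<subseteq> param_space s" "US s \<subseteq> param_space s"
    and p: "(\<eta>x, \<eta>u) \<in> minimizers1 A B x0 \<tau> XS US s" "(\<eta>x', \<eta>u') \<in> minimizers1 A B x0 \<tau> XS US s"
  shows "\<eta>x = \<eta>x'" "\<eta>u = \<eta>u'"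
proof -
  have f: "(\<eta>x, \<eta>u) \<in> feasible1 A B x0 \<tau> XS US s" "(\<eta>x', \<eta>u') \<in> feasible1 A B x0 \<tau> XS US s"
    and J: "ereal (param_cost \<tau> s \<eta>x \<eta>u) = J1 A B x0 \<tau> XS US s"
      "ereal (param_cost \<tau> s \<eta>x' \<eta>u') = J1 A B x0 \<tau> XS US s"
    using p by (auto simp: minimizers1_def)
  then have eq: "param_cost \<tau> s \<eta>x' \<eta>u' = param_cost \<tau> s \<eta>x \<eta>u" by (metis ereal.inject)
  have le: "param_cost \<tau> s (\<eta>x - \<eta>x') (\<eta>u - \<eta>u') \<le> 0"
    using almost_minimizers1_close[OF assms(1,2) f eq_refl[OF J(1)], of 0 0] eq by simp
  have in_space: "\<eta>x \<in> param_space s" "\<eta>x' \<in> param_space s" "\<eta>u \<in> param_space s" "\<eta>u' \<in> param_space s"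
    using f assms(3,4) by (auto simp: feasible1_iff)
  have "(Poly_Mapping.lookup (\<eta>x - \<eta>x') (i, k))\<^sup>2 \<le> 0" "(Poly_Mapping.lookup (\<eta>u - \<eta>u') (j, k))\<^sup>2 \<le> 0"
    if "k < s" for i j k
    using le lookup_square_le_param_cost(1)[OF that, of "\<eta>x - \<eta>x'" i "\<eta>u - \<eta>u'"]
      lookup_square_le_param_cost(2)[OF that, of "\<eta>u - \<eta>u'" j "\<eta>x - \<eta>x'"] by linarith+
  then have "Poly_Mapping.lookup \<eta>x (i, k) = Poly_Mapping.lookup \<eta>x' (i, k)"
    "Poly_Mapping.lookup \<eta>u (j, k) = Poly_Mapping.lookup \<eta>u' (j, k)" if "k < s" for i j k
    using that by (auto simp: lookup_minus)
  then show "\<eta>x = \<eta>x'" "\<eta>u = \<eta>u'"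
    using in_space by (auto intro: param_eqI)
qed

text \<open>Feasible points with excess 1 / (n + 1) form a Cauchy sequence by
  \<open>almost_minimizers1_close\<close>, so all coordinates converge. The limit stays in the
  closed sets, and the equations and the cost are continuous in the coefficients.\<close>

lemma minimizers1_nonempty:
  assumes closed: "closed (XS s)" "closed (US s)" and convex: "convex (XS s)" "convex (US s)"
    and sub: "XS s \<subseteq> param_space s" "US s \<subseteq> param_space s"
    and fin: "J1 A B x0 \<tau> XS US s = ereal j"
  shows "\<exists>\<eta>. \<eta> \<in> minimizers1 A B x0 \<tau> XS US s"
proof -
  let ?F = "feasible1 A B x0 \<tau> XS US s"
  have "\<exists>x u. (x, u) \<in> ?F \<and> param_cost \<tau> s x u \<le> j + 1 / real (Suc n)" for n
  proof -
    have "(INF (\<eta>x, \<eta>u) \<in> ?F. ereal (param_cost \<tau> s \<eta>x \<eta>u)) < ereal (j + 1 / real (Suc n))"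
      using fin unfolding J1_def by simp
    then obtain a b where "(a, b) \<in> ?F" "ereal (param_cost \<tau> s a b) < ereal (j + 1 / real (Suc n))"
      unfolding INF_less_iff by auto
    then have "(a, b) \<in> ?F \<and> param_cost \<tau> s a b \<le> j + 1 / real (Suc n)"
      by (simp only: less_ereal.simps less_imp_le simp_thms)
    then show ?thesis by blast
  qed
  then obtain x u where F: "\<And>n. (x n, u n) \<in> ?F"
    and le: "\<And>n. param_cost \<tau> s (x n) (u n) \<le> j + 1 / real (Suc n)"
    by metis
  have in_space: "x n \<in> param_space s" "u n \<in> param_space s" for n
    using F[of n] sub by (auto simp: feasible1_iff)
  have close: "param_cost \<tau> s (x m - x n) (u m - u n) \<le> 2 * (1 / real (Suc m)) + 2 * (1 / real (Suc n))" for m n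
    by (rule almost_minimizers1_close[OF convex F F _ le le]) (simp add: fin)
  have conv: "convergent a"
    if a: "\<And>m n. (a m - a n)\<^sup>2 \<le> 2 * param_cost \<tau> s (x m - x n) (u m - u n)" for a :: "nat \<Rightarrow> real"
  proof -
    have "Cauchy a"
    proof (rule CauchyI)
      fix e :: real assume "e > 0"
      \<comment> \<open>For m, n \<ge> N the squared difference is at most 4 / (m + 1) + 4 / (n +
        1), hence below 8 / N.\<close>
      then obtain N where N: "8 / e\<^sup>2 < real N"
        using reals_Archimedean2 by blast
      have "norm (a m - a n) < e" if "m \<ge> N" "n \<ge> N" for m n
      proof (rule power2_less_imp_less)
        have pos: "real N > 0" using N \<open>e > 0\<close> by (smt (verit) divide_pos_pos zero_less_power)
        have "1 / real (Suc m) < 1 / real N" "1 / real (Suc n) < 1 / real N"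
          using that pos by (auto intro!: divide_strict_left_mono)
        then have "(norm (a m - a n))\<^sup>2 < 8 / real N"
          using a[of m n] close[of m n] by simp
        also have "\<dots> < e\<^sup>2"
          using N pos \<open>e > 0\<close> by (simp add: field_simps)
        finally show "(norm (a m - a n))\<^sup>2 < e\<^sup>2" .
      qed (use \<open>e > 0\<close> in simp)
      then show "\<exists>M. \<forall>m\<ge>M. \<forall>n\<ge>M. norm (a m - a n) < e" by blast
    qed
    then show ?thesis by (simp add: Cauchy_convergent_iff)
  qed
  define cx where "cx i k = lim (\<lambda>n. Poly_Mapping.lookup (x n) (i, k))" for i k
  have "convergent (\<lambda>n. Poly_Mapping.lookup (x n) (i, k))" if "k < s" for i k
    by (rule conv) (use lookup_square_le_param_cost(1)[OF that, of "x _ - x _" i] in \<open>simp add: lookup_minus\<close>)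
  then have cx: "(\<lambda>n. Poly_Mapping.lookup (x n) (i, k)) \<longlonglongrightarrow> cx i k" if "k < s" for i k
    using that by (simp add: cx_def convergent_LIMSEQ_iff)
  define cu where "cu i k = lim (\<lambda>n. Poly_Mapping.lookup (u n) (i, k))" for i k
  have "convergent (\<lambda>n. Poly_Mapping.lookup (u n) (i, k))" if "k < s" for i k
    by (rule conv) (use lookup_square_le_param_cost(2)[OF that, of "u _ - u _" i] in \<open>simp add: lookup_minus\<close>)
  then have cu: "(\<lambda>n. Poly_Mapping.lookup (u n) (i, k)) \<longlonglongrightarrow> cu i k" if "k < s" for i k
    using that by (simp add: cu_def convergent_LIMSEQ_iff)
  define x' where "x' = mk_param s cx"
  define u' where "u' = mk_param s cu"
  have lx: "(\<lambda>n. Poly_Mapping.lookup (x n) (i, k)) \<longlonglongrightarrow> Poly_Mapping.lookup x' (i, k)" for i k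
    using cx[of k i] by (cases "k < s") (auto simp: x'_def lookup_mk_param lookup_param_space[OF in_space(1)])
  have lu: "(\<lambda>n. Poly_Mapping.lookup (u n) (i, k)) \<longlonglongrightarrow> Poly_Mapping.lookup u' (i, k)" for i k
    using cu[of k i] by (cases "k < s") (auto simp: u'_def lookup_mk_param lookup_param_space[OF in_space(2)])
  have in_space': "x' \<in> param_space s" "u' \<in> param_space s"
    unfolding x'_def u'_def by (rule mk_param_in_param_space)+
  have "(\<lambda>n. Poly_Mapping.lookup (x n) p) \<longlonglongrightarrow> Poly_Mapping.lookup x' p" for p
    using lx[of "fst p" "snd p"] by simp
  then have x_lim: "x \<longlonglongrightarrow> x'"
    by (rule param_space_tendsto[OF in_space(1) in_space'(1)])
  have "(\<lambda>n. Poly_Mapping.lookup (u n) p) \<longlonglongrightarrow> Poly_Mapping.lookup u' p" for p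
    using lu[of "fst p" "snd p"] by simp
  then have u_lim: "u \<longlonglongrightarrow> u'"
    by (rule param_space_tendsto[OF in_space(2) in_space'(2)])
  have "x n \<in> XS s" "u n \<in> US s" for n
    using F[of n] by (auto simp: feasible1_iff)
  then have "x' \<in> XS s" "u' \<in> US s"
    using closed_sequentially[OF closed(1) _ x_lim] closed_sequentially[OF closed(2) _ u_lim] by auto
  moreover have "residual_coeff A B s x' u' i k = 0" if "k < s" for i k
  proof (rule LIMSEQ_unique)
    show "(\<lambda>n. residual_coeff A B s (x n) (u n) i k) \<longlonglongrightarrow> residual_coeff A B s x' u' i k"
      unfolding residual_coeff_def by (intro tendsto_intros lx lu)
    show "(\<lambda>n. residual_coeff A B s (x n) (u n) i k) \<longlonglongrightarrow> 0"
      using F that by (simp add: feasible1_iff)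
  qed
  moreover have "(\<Sum>k<s. Poly_Mapping.lookup x' (i, k) * \<tau> k 0) = x0 $ i" for i
  proof (rule LIMSEQ_unique)
    show "(\<lambda>n. \<Sum>k<s. Poly_Mapping.lookup (x n) (i, k) * \<tau> k 0) \<longlonglongrightarrow> (\<Sum>k<s. Poly_Mapping.lookup x' (i, k) * \<tau> k 0)"
      by (intro tendsto_intros lx)
    show "(\<lambda>n. \<Sum>k<s. Poly_Mapping.lookup (x n) (i, k) * \<tau> k 0) \<longlonglongrightarrow> x0 $ i"
      using F by (simp add: feasible1_iff)
  qed
  ultimately have F': "(x', u') \<in> ?F" by (simp add: feasible1_iff)
  have "param_cost \<tau> s x' u' \<le> j + 0"
  proof (rule LIMSEQ_le)
    show "(\<lambda>n. param_cost \<tau> s (x n) (u n)) \<longlonglongrightarrow> param_cost \<tau> s x' u'"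
      unfolding param_cost_eq by (intro tendsto_intros lx lu)
    show "(\<lambda>n. j + 1 / real (Suc n)) \<longlonglongrightarrow> j + 0"
      by (intro tendsto_intros LIMSEQ_inverse_real_of_nat[unfolded inverse_eq_divide])
  qed (use le in auto)
  moreover have "ereal j \<le> ereal (param_cost \<tau> s x' u')"
    unfolding fin[symmetric] J1_def by (rule INF_lower2[OF F']) simp
  ultimately have "(x', u') \<in> minimizers1 A B x0 \<tau> XS US s"
    using F' fin by (simp add: minimizers1_def)
  then show ?thesis by blast
qed

section \<open>Monotonicity in s and comparison with the full problem\<close>

text \<open>The parameter describes the same trajectory at both levels, and its residual is zero at
  every t \<ge> 0; the additional test function \<open>\<tau> s\<close> therefore imposes nothing
  new.\<close>

lemma feasible1_Suc:
  fixes XS :: "nat \<Rightarrow> ('n::finite) param set" and US :: "nat \<Rightarrow> ('m::finite) param set"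
  assumes f: "(\<eta>x, \<eta>u) \<in> feasible1 A B x0 \<tau> XS US s"
    and sub: "XS s \<subseteq> param_space s" "US s \<subseteq> param_space s"
    and incl: "incl \<tau> s ` XS s \<subseteq> XS (Suc s)" "incl \<tau> s ` US s \<subseteq> US (Suc s)"
  shows "(\<eta>x, \<eta>u) \<in> feasible1 A B x0 \<tau> XS US (Suc s)"
    "param_cost \<tau> (Suc s) \<eta>x \<eta>u = param_cost \<tau> s \<eta>x \<eta>u"
proof -
  have in_space: "\<eta>x \<in> param_space s" "\<eta>u \<in> param_space s"
    using f sub by (auto simp: feasible1_def)
  have traj_eq: "traj \<tau> (Suc s) \<eta>x = traj \<tau> s \<eta>x" "traj \<tau> (Suc s) \<eta>u = traj \<tau> s \<eta>u"
    using in_space by (auto intro: traj_mono)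
  have "\<eta>x \<in> XS (Suc s)" "\<eta>u \<in> US (Suc s)"
    using f incl incl_eq[OF in_space(1)] incl_eq[OF in_space(2)] by (auto simp: feasible1_def image_subset_iff)
  moreover have "proj \<tau> (Suc s) (residual A B \<tau> (Suc s) \<eta>x \<eta>u) = 0"
  proof -
    have "residual A B \<tau> (Suc s) \<eta>x \<eta>u t = 0" if "t \<ge> 0" for t
      using residual_eq_0[of s A B \<eta>x \<eta>u t] that f
      by (simp add: residual_def traj_eq feasible1_def)
    then have "(LINT t|halfline. \<tau> k t * residual A B \<tau> (Suc s) \<eta>x \<eta>u t $ i) = (LINT t|halfline. 0)" for i k
      by (intro Bochner_Integration.integral_cong) auto
    then show ?thesis
      by (intro poly_mapping_eqI) (auto simp: proj_def lookup_mk_param)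
  qed
  ultimately show "(\<eta>x, \<eta>u) \<in> feasible1 A B x0 \<tau> XS US (Suc s)"
    using f by (simp add: feasible1_def traj_eq)
  show "param_cost \<tau> (Suc s) \<eta>x \<eta>u = param_cost \<tau> s \<eta>x \<eta>u"
    by (simp add: param_cost_def traj_eq)
qed

text \<open>A zero residual makes the trajectory a classical solution. Its right-hand side A x + B u
  is square integrable and serves as the derivative required by \<open>feasible_inf\<close>.\<close>

lemma J_inf_le_J1:
  fixes XS :: "nat \<Rightarrow> ('n::finite) param set" and US :: "nat \<Rightarrow> ('m::finite) param set"
  assumes X: "\<And>\<eta>x t. \<eta>x \<in> XS s \<Longrightarrow> t \<ge> 0 \<Longrightarrow> traj \<tau> s \<eta>x t \<in> X"
    and U: "\<And>\<eta>u t. \<eta>u \<in> US s \<Longrightarrow> t \<ge> 0 \<Longrightarrow> traj \<tau> s \<eta>u t \<in> U"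
  shows "J_inf A B x0 X U \<le> J1 A B x0 \<tau> XS US s"
  unfolding J1_def
proof (rule INF_greatest, clarify)
  fix \<eta>x \<eta>u assume f: "(\<eta>x, \<eta>u) \<in> feasible1 A B x0 \<tau> XS US s"
  let ?x' = "\<lambda>t. A *v traj \<tau> s \<eta>x t + B *v traj \<tau> s \<eta>u t"
  have deriv: "(traj \<tau> s \<eta>x has_vector_derivative ?x' t) (at t within {0..})" if "t \<ge> 0" for t
  proof -
    have "vector_derivative (traj \<tau> s \<eta>x) (at t within {0..}) = ?x' t"
      using residual_eq_0[OF _ that, of s A B \<eta>x \<eta>u] f by (simp add: residual_def feasible1_def)
    then show ?thesis
      using differentiableI_vector[OF traj_has_vector_derivative[OF that, of s \<eta>x]]
      by (metis vector_derivative_works)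
  qed
  have "has_L2_derivative (traj \<tau> s \<eta>x) ?x'"
    unfolding has_L2_derivative_def
  proof (intro conjI allI impI)
    show "?x' \<in> L2"
      by (intro L2_add L2_matrix_vector_mult traj_L2)
    fix t :: real assume t: "t \<ge> 0"
    show "(?x' has_integral (traj \<tau> s \<eta>x t - traj \<tau> s \<eta>x 0)) {0..t}"
      by (rule fundamental_theorem_of_calculus[OF t])
        (rule has_vector_derivative_within_subset[OF deriv], auto)
  qed
  then have "(traj \<tau> s \<eta>x, traj \<tau> s \<eta>u) \<in> feasible_inf A B x0 X U"
    using f X U by (auto simp: feasible_inf_def feasible1_def traj_L2)
  then show "J_inf A B x0 X U \<le> ereal (param_cost \<tau> s \<eta>x \<eta>u)"
    unfolding J_inf_def param_cost_def by (rule INF_lower2) simp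
qed

lemma J1_nonneg: "0 \<le> J1 A B x0 \<tau> XS US s"
  unfolding J1_def by (rule INF_greatest) (auto simp: param_cost_nonneg)

lemma J2_nonneg: "0 \<le> J2 A B x0 \<tau> XT UT s"
  unfolding J2_def by (rule INF_greatest) (auto simp: param_cost_nonneg)

lemma J2_le_Suc:
  fixes XT :: "nat \<Rightarrow> ('n::finite) param set" and UT :: "nat \<Rightarrow> ('m::finite) param set"
  assumes "proj_step \<tau> s ` XT (Suc s) \<subseteq> XT s" "proj_step \<tau> s ` UT (Suc s) \<subseteq> UT s"
  shows "J2 A B x0 \<tau> XT UT s \<le> J2 A B x0 \<tau> XT UT (Suc s)"
  unfolding J2_def[of A B x0 \<tau> XT UT "Suc s"]
proof (rule INF_greatest, clarify)
  fix \<eta>x \<eta>u assume f: "(\<eta>x, \<eta>u) \<in> feasible2 A B x0 \<tau> XT UT (Suc s)"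
  have "(proj_step \<tau> s \<eta>x, proj_step \<tau> s \<eta>u) \<in> feasible2 A B x0 \<tau> XT UT s"
    \<comment> \<open>For k < s the equations read only coefficients with index at most k, and
      truncation keeps those.\<close>
    using f assms unfolding feasible2_iff by (auto simp: lookup_proj_step)
  then have "J2 A B x0 \<tau> XT UT s \<le> ereal (param_cost \<tau> s (proj_step \<tau> s \<eta>x) (proj_step \<tau> s \<eta>u))"
    unfolding J2_def by (rule INF_lower2) simp
  also have "param_cost \<tau> s (proj_step \<tau> s \<eta>x) (proj_step \<tau> s \<eta>u) \<le> param_cost \<tau> (Suc s) \<eta>x \<eta>u"
    unfolding param_cost_eq
    by (intro add_mono mult_left_mono sum_mono) (auto simp: lookup_proj_step)
  finally show "J2 A B x0 \<tau> XT UT s \<le> ereal (param_cost \<tau> (Suc s) \<eta>x \<eta>u)" by simp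
qed

lemma J2_le_J_inf:
  fixes XT :: "nat \<Rightarrow> ('n::finite) param set" and UT :: "nat \<Rightarrow> ('m::finite) param set"
  assumes X: "\<And>x. x \<in> L2 \<Longrightarrow> (\<And>t. t \<ge> 0 \<Longrightarrow> x t \<in> X) \<Longrightarrow> proj \<tau> s x \<in> XT s"
    and U: "\<And>u. u \<in> L2 \<Longrightarrow> (\<And>t. t \<ge> 0 \<Longrightarrow> u t \<in> U) \<Longrightarrow> proj \<tau> s u \<in> UT s"
  shows "J2 A B x0 \<tau> XT UT s \<le> J_inf A B x0 X U"
  unfolding J_inf_def
proof (rule INF_greatest, clarify)
  fix x u assume f: "(x, u) \<in> feasible_inf A B x0 X U"
  then obtain x' where L2: "x \<in> L2" "u \<in> L2" "x' \<in> L2" and x0: "x 0 = x0"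
    and prim: "\<And>t. t \<ge> 0 \<Longrightarrow> (x' has_integral (x t - x 0)) {0..t}"
    and ode: "AE t in halfline. x' t = A *v x t + B *v u t"
    and mem: "\<And>t. t \<ge> 0 \<Longrightarrow> x t \<in> X" "\<And>t. t \<ge> 0 \<Longrightarrow> u t \<in> U"
    by (auto simp: feasible_inf_def has_L2_derivative_def)
  have lookup: "Poly_Mapping.lookup (proj \<tau> s y) (i, k) = (if k < s then (LINT t|halfline. \<tau> k t * y t $ i) else 0)"
    for y :: "real \<Rightarrow> real^('q::finite)" and i k
    by (simp add: proj_def lookup_mk_param)
  have cons: "(\<Sum>j\<in>UNIV. A $ i $ j * Poly_Mapping.lookup (proj \<tau> s x) (j, k))
      + (\<Sum>j\<in>UNIV. B $ i $ j * Poly_Mapping.lookup (proj \<tau> s u) (j, k))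
      + (\<Sum>l\<le>k. D k l * Poly_Mapping.lookup (proj \<tau> s x) (i, l)) + \<tau> k 0 * x0 $ i = 0"
    if k: "k < s" for i k
  proof -
    have ix: "integrable halfline (\<lambda>t. \<tau> k t * x t $ j)" for j
      by (intro L2_integrable_mult \<tau>_L2 L2_comp L2)
    have iu: "integrable halfline (\<lambda>t. \<tau> k t * u t $ j)" for j
      by (intro L2_integrable_mult \<tau>_L2 L2_comp L2)
    \<comment> \<open>The differential equation holds almost everywhere, which is enough once both
      sides are integrated against \<tau> k.\<close>
    have "(LINT t|halfline. \<tau> k t * x' t $ i) = (LINT t|halfline. \<tau> k t * (A *v x t + B *v u t) $ i)"
    proof (rule integral_cong_AE)
      show "(\<lambda>t. \<tau> k t * x' t $ i) \<in> borel_measurable halfline"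
        by (intro borel_measurable_times L2_measurable \<tau>_L2 L2_comp L2)
      show "(\<lambda>t. \<tau> k t * (A *v x t + B *v u t) $ i) \<in> borel_measurable halfline"
        by (intro borel_measurable_times L2_measurable \<tau>_L2 L2_comp L2_add L2_matrix_vector_mult L2)
      show "AE t in halfline. \<tau> k t * x' t $ i = \<tau> k t * (A *v x t + B *v u t) $ i"
        using ode by eventually_elim simp
    qed
    also have "\<dots> = (LINT t|halfline. (\<Sum>j\<in>UNIV. A $ i $ j * (\<tau> k t * x t $ j)) + (\<Sum>j\<in>UNIV. B $ i $ j * (\<tau> k t * u t $ j)))"
      by (simp add: matrix_vector_mult_def distrib_left sum_distrib_left mult_ac)
    also have "\<dots> = (\<Sum>j\<in>UNIV. A $ i $ j * (LINT t|halfline. \<tau> k t * x t $ j))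
        + (\<Sum>j\<in>UNIV. B $ i $ j * (LINT t|halfline. \<tau> k t * u t $ j))"
      using ix iu by simp
    finally have "(LINT t|halfline. \<tau> k t * x' t $ i) = \<dots>" .
    moreover have "(LINT t|halfline. \<tau> k t * x' t $ i) + (\<Sum>l\<le>k. D k l * (LINT t|halfline. \<tau> l t * x t $ i))
        = - \<tau> k 0 * x 0 $ i"
      using has_integral_cart_component[OF prim, of _ i]
      by (intro integration_by_parts L2_comp L2) simp
    ultimately show ?thesis
      using k by (simp add: lookup x0)
  qed
  have "(proj \<tau> s x, proj \<tau> s u) \<in> feasible2 A B x0 \<tau> XT UT s"
    unfolding feasible2_iff using X[OF L2(1) mem(1)] U[OF L2(2) mem(2)] cons by blast
  then have "J2 A B x0 \<tau> XT UT s \<le> ereal (param_cost \<tau> s (proj \<tau> s x) (proj \<tau> s u))"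
    unfolding J2_def by (rule INF_lower2) simp
  also have "param_cost \<tau> s (proj \<tau> s x) (proj \<tau> s u) \<le> cost x u"
    unfolding param_cost_eq cost_def L2_norm_square_cart[OF L2(1)] L2_norm_square_cart[OF L2(2)]
    by (intro add_mono mult_left_mono sum_mono) (auto simp: lookup intro!: Bessel L2_comp L2)
  finally show "J2 A B x0 \<tau> XT UT s \<le> ereal (cost x u)" by simp
qed

section \<open>Convergence of the costs and of the optimizers\<close>

text \<open>From \<open>N0\<close> on the costs are real, decreasing and nonnegative, so they
  converge. An optimizer for s is feasible for every r \<ge> s at unchanged cost, with excess j s -
  j r there; convergence of the costs thus forces the optimizers together.\<close>

lemma first_approximation:
  fixes XS :: "nat \<Rightarrow> ('n::finite) param set" and US :: "nat \<Rightarrow> ('m::finite) param set"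
  assumes closed: "\<And>s. s \<ge> 1 \<Longrightarrow> closed (XS s)" "\<And>s. s \<ge> 1 \<Longrightarrow> closed (US s)"
    and convex: "\<And>s. s \<ge> 1 \<Longrightarrow> convex (XS s)" "\<And>s. s \<ge> 1 \<Longrightarrow> convex (US s)"
    and sub: "\<And>s. s \<ge> 1 \<Longrightarrow> XS s \<subseteq> param_space s" "\<And>s. s \<ge> 1 \<Longrightarrow> US s \<subseteq> param_space s"
    and incl: "\<And>s. s \<ge> 1 \<Longrightarrow> incl \<tau> s ` XS s \<subseteq> XS (Suc s)" "\<And>s. s \<ge> 1 \<Longrightarrow> incl \<tau> s ` US s \<subseteq> US (Suc s)"
    and N0: "N0 \<ge> 1" "\<bar>J1 A B x0 \<tau> XS US N0\<bar> \<noteq> \<infinity>"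
  shows "N0 \<le> s \<Longrightarrow> s \<le> r \<Longrightarrow> J1 A B x0 \<tau> XS US r \<le> J1 A B x0 \<tau> XS US s"
    and "\<exists>l::real. J1 A B x0 \<tau> XS US \<longlonglongrightarrow> ereal l"
    and "N0 \<le> s \<Longrightarrow> \<exists>!\<eta>. \<eta> \<in> minimizers1 A B x0 \<tau> XS US s"
    and "\<exists>x u. x \<in> L2 \<and> u \<in> L2 \<and>
      (\<forall>\<eta>x \<eta>u. (\<forall>s\<ge>N0. (\<eta>x s, \<eta>u s) \<in> minimizers1 A B x0 \<tau> XS US s) \<longrightarrow>
        (\<lambda>s. L2_norm (\<lambda>t. traj \<tau> s (\<eta>x s) t - x t)) \<longlonglongrightarrow> 0 \<and>
        (\<lambda>s. L2_norm (\<lambda>t. traj \<tau> s (\<eta>u s) t - u t)) \<longlonglongrightarrow> 0)"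
proof -
  let ?J = "J1 A B x0 \<tau> XS US" and ?F = "feasible1 A B x0 \<tau> XS US"
  have mono: "p \<in> ?F r \<and> param_cost \<tau> r (fst p) (snd p) = param_cost \<tau> s (fst p) (snd p)"
    if "N0 \<le> s" "s \<le> r" "p \<in> ?F s" for s r p
    using that(2)
  proof (induction r rule: dec_induct)
    case base
    show ?case using that by simp
  next
    case (step r)
    then have r: "r \<ge> 1" using that N0 by simp
    have "(fst p, snd p) \<in> ?F r" using step.IH by simp
    from feasible1_Suc[OF this sub[OF r] incl[OF r]] show ?case
      using step.IH by simp
  qed
  show J_mono: "?J r \<le> ?J s" if "N0 \<le> s" "s \<le> r" for s r
    unfolding J1_def[of A B x0 \<tau> XS US s]
  proof (rule INF_greatest)
    fix p assume "p \<in> ?F s"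
    from mono[OF that this]
    show "?J r \<le> (case p of (\<eta>x, \<eta>u) \<Rightarrow> ereal (param_cost \<tau> s \<eta>x \<eta>u))"
      unfolding J1_def by (intro INF_lower2[of p]) (auto simp: case_prod_beta)
  qed
  have "\<exists>j\<ge>0. ?J s = ereal j" if "s \<ge> N0" for s
  proof -
    obtain b where "?J N0 = ereal b" using N0(2) by (cases "?J N0") auto
    with J_mono[OF order_refl that] show ?thesis
      by (intro ereal_sandwich_real[OF J1_nonneg]) simp
  qed
  then obtain j where j: "\<And>s. s \<ge> N0 \<Longrightarrow> ?J s = ereal (j s)" "\<And>s. s \<ge> N0 \<Longrightarrow> j s \<ge> 0"
    by metis
  \<comment> \<open>The shift skips the indices below \<open>N0\<close>, where the problem may be
    infeasible and j is unspecified.\<close>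
  have "decseq (\<lambda>n. j (n + N0))"
    unfolding decseq_def using J_mono j(1) by (metis add_le_cancel_right ereal_less_eq(3) le_add2)
  then obtain l where l: "(\<lambda>n. j (n + N0)) \<longlonglongrightarrow> l" "\<And>n. l \<le> j (n + N0)"
    using decseq_convergent[of "\<lambda>n. j (n + N0)" 0] j(2) by (metis le_add2)
  then have "(\<lambda>n. ?J (n + N0)) \<longlonglongrightarrow> ereal l"
    by (simp add: j(1))
  then show "\<exists>l::real. ?J \<longlonglongrightarrow> ereal l"
    by (intro exI[of _ l]) (rule LIMSEQ_offset)
  have ex: "\<exists>!\<eta>. \<eta> \<in> minimizers1 A B x0 \<tau> XS US s" if "s \<ge> N0" for s
  proof -
    have s: "s \<ge> 1" using that N0 by simp
    show ?thesis
    proof (rule ex_ex1I)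
      show "\<exists>\<eta>. \<eta> \<in> minimizers1 A B x0 \<tau> XS US s"
        by (rule minimizers1_nonempty[OF closed[OF s] convex[OF s] sub[OF s] j(1)[OF that]])
      fix p q assume "p \<in> minimizers1 A B x0 \<tau> XS US s" "q \<in> minimizers1 A B x0 \<tau> XS US s"
      then have "(fst p, snd p) \<in> minimizers1 A B x0 \<tau> XS US s" "(fst q, snd q) \<in> minimizers1 A B x0 \<tau> XS US s"
        by simp_all
      from minimizers1_unique[where XS = XS and US = US and s = s, OF convex[OF s] sub[OF s] this]
      show "p = q" by (simp add: prod_eq_iff)
    qed
  qed
  then show "N0 \<le> s \<Longrightarrow> \<exists>!\<eta>. \<eta> \<in> minimizers1 A B x0 \<tau> XS US s" .
  from ex obtain p where p: "\<And>s. s \<ge> N0 \<Longrightarrow> p s \<in> minimizers1 A B x0 \<tau> XS US s"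
    by metis
  define \<xi> where "\<xi> s = fst (p s)" for s
  define \<upsilon> where "\<upsilon> s = snd (p s)" for s
  have min: "(\<xi> s, \<upsilon> s) \<in> ?F s" "param_cost \<tau> s (\<xi> s) (\<upsilon> s) = j s" if "s \<ge> N0" for s
    using p[OF that] j(1)[OF that] by (auto simp: minimizers1_def \<xi>_def \<upsilon>_def)
  have close: "param_cost \<tau> r (\<xi> s - \<xi> r) (\<upsilon> s - \<upsilon> r) \<le> 2 * (j s - j r)" if "N0 \<le> s" "s \<le> r" for s r
  proof -
    have r: "r \<ge> N0" "r \<ge> 1" using that N0 by auto
    from mono[OF that min(1)[OF that(1)]]
    have f: "(\<xi> s, \<upsilon> s) \<in> ?F r" and c: "param_cost \<tau> r (\<xi> s) (\<upsilon> s) = j s"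
      by (simp_all add: min(2)[OF that(1)])
    show ?thesis
      \<comment> \<open>At level r the old optimizer has excess j s - j r and the new one excess
        0.\<close>
      using almost_minimizers1_close[where XS = XS and US = US and s = r, OF convex[OF r(2)] f min(1)[OF r(1)], of "j r" "j s - j r" 0]
        c min(2)[OF r(1)] j(1)[OF r(1)] by simp
  qed
  have norm_close: "L2_norm (\<lambda>t. traj \<tau> s (\<xi> s) t - traj \<tau> r (\<xi> r) t) \<le> 2 * sqrt (j s - j r)"
      "L2_norm (\<lambda>t. traj \<tau> s (\<upsilon> s) t - traj \<tau> r (\<upsilon> r) t) \<le> 2 * sqrt (j s - j r)"
    if "N0 \<le> s" "s \<le> r" for s r
  proof -
    have s: "s \<ge> 1" using that N0 by simp
    have in_space: "\<xi> s \<in> param_space s" "\<upsilon> s \<in> param_space s"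
      using min(1)[OF that(1)] sub[OF s] by (auto simp: feasible1_def)
    have diff: "(\<lambda>t. traj \<tau> s \<zeta> t - traj \<tau> r \<zeta>' t) = traj \<tau> r (\<zeta> - \<zeta>')"
      if "\<zeta> \<in> param_space s" for \<zeta> \<zeta>' :: "('q::finite) param"
      unfolding traj_mono[OF that \<open>s \<le> r\<close>, symmetric]
      by (auto simp: fun_eq_iff Finite_Cartesian_Product.vec_eq_iff traj_comp expansion_def lookup_minus sum_subtractf algebra_simps)
    \<comment> \<open>The cost is half the sum of the two squared norms, which turns the constant 2
      of \<open>close\<close> into 4 and later into 2 in front of the root.\<close>
    have "(L2_norm (traj \<tau> r (\<xi> s - \<xi> r)))\<^sup>2 + (L2_norm (traj \<tau> r (\<upsilon> s - \<upsilon> r)))\<^sup>2 \<le> 4 * (j s - j r)"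
      using close[OF that] unfolding param_cost_def cost_def by simp
    then have sq: "(L2_norm (traj \<tau> r (\<xi> s - \<xi> r)))\<^sup>2 \<le> 4 * (j s - j r)"
      "(L2_norm (traj \<tau> r (\<upsilon> s - \<upsilon> r)))\<^sup>2 \<le> 4 * (j s - j r)"
      by (smt (verit) zero_le_power2)+
    have four: "sqrt (4 * (j s - j r)) = 2 * sqrt (j s - j r)"
      by (simp only: real_sqrt_mult real_sqrt_four)
    show "L2_norm (\<lambda>t. traj \<tau> s (\<xi> s) t - traj \<tau> r (\<xi> r) t) \<le> 2 * sqrt (j s - j r)"
      using real_le_rsqrt[OF sq(1)] diff[OF in_space(1), of "\<xi> r"] four by simp
    show "L2_norm (\<lambda>t. traj \<tau> s (\<upsilon> s) t - traj \<tau> r (\<upsilon> r) t) \<le> 2 * sqrt (j s - j r)"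
      using real_le_rsqrt[OF sq(2)] diff[OF in_space(2), of "\<upsilon> r"] four by simp
  qed
  have Cauchy: "\<exists>N. \<forall>m\<ge>N. \<forall>n\<ge>N. L2_norm (\<lambda>t. f m t - f n t) \<le> e"
    if bound: "\<And>s r. N0 \<le> s \<Longrightarrow> s \<le> r \<Longrightarrow> L2_norm (\<lambda>t. f s t - f r t) \<le> 2 * sqrt (j s - j r)" and "e > 0"
    for f :: "nat \<Rightarrow> real \<Rightarrow> 'z::euclidean_space" and e :: real
  proof -
    \<comment> \<open>The norm bound is 2 sqrt (j s - j r), so costs within (e / 2)^2 of their limit
      l give distances of at most e.\<close>
    have "0 < (e / 2)\<^sup>2" using \<open>e > 0\<close> by simp
    then have "\<forall>\<^sub>F n in sequentially. j (n + N0) < l + (e / 2)\<^sup>2"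
      by (intro order_tendstoD(2)[OF l(1)]) simp
    then obtain K where K: "\<And>n. n \<ge> K \<Longrightarrow> j (n + N0) < l + (e / 2)\<^sup>2"
      by (auto simp: eventually_sequentially)
    have le: "L2_norm (\<lambda>t. f s t - f r t) \<le> e" if "K + N0 \<le> s" "s \<le> r" for s r
    proof -
      have "j s < l + (e / 2)\<^sup>2" using K[of "s - N0"] that by simp
      moreover have "l \<le> j r" using l(2)[of "r - N0"] that by simp
      ultimately have "sqrt (j s - j r) \<le> sqrt ((e / 2)\<^sup>2)"
        by (intro real_sqrt_le_mono) simp
      then show ?thesis using bound[of s r] that \<open>e > 0\<close> by simp
    qed
    have "L2_norm (\<lambda>t. f m t - f n t) \<le> e" if "K + N0 \<le> m" "K + N0 \<le> n" for m n
      using le[of m n] le[of n m] that L2_norm_minus_commute[of "f m" "f n"] by (cases "m \<le> n") auto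
    then show ?thesis by blast
  qed
  obtain x where x: "x \<in> L2" "(\<lambda>s. L2_norm (\<lambda>t. traj \<tau> s (\<xi> s) t - x t)) \<longlonglongrightarrow> 0"
    using L2_complete[OF traj_L2 Cauchy[OF norm_close(1)]] by blast
  obtain u where u: "u \<in> L2" "(\<lambda>s. L2_norm (\<lambda>t. traj \<tau> s (\<upsilon> s) t - u t)) \<longlonglongrightarrow> 0"
    using L2_complete[OF traj_L2 Cauchy[OF norm_close(2)]] by blast
  show "\<exists>x u. x \<in> L2 \<and> u \<in> L2 \<and>
      (\<forall>\<eta>x \<eta>u. (\<forall>s\<ge>N0. (\<eta>x s, \<eta>u s) \<in> minimizers1 A B x0 \<tau> XS US s) \<longrightarrow>
        (\<lambda>s. L2_norm (\<lambda>t. traj \<tau> s (\<eta>x s) t - x t)) \<longlonglongrightarrow> 0 \<and>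
        (\<lambda>s. L2_norm (\<lambda>t. traj \<tau> s (\<eta>u s) t - u t)) \<longlonglongrightarrow> 0)"
  proof (rule exI[of _ x], rule exI[of _ u], intro conjI allI impI x(1) u(1))
    fix \<eta>x \<eta>u assume \<eta>: "\<forall>s\<ge>N0. (\<eta>x s, \<eta>u s) \<in> minimizers1 A B x0 \<tau> XS US s"
    \<comment> \<open>The limits x and u are fixed before the sequence of optimizers is given. By
      uniqueness any such sequence agrees with the chosen one from \<open>N0\<close> on, and earlier
      terms do not affect the limit.\<close>
    have eq: "\<xi> s = \<eta>x s \<and> \<upsilon> s = \<eta>u s" if "s \<ge> N0" for s
    proof -
      have "p s = (\<eta>x s, \<eta>u s)" using ex[OF that] p[OF that] \<eta> that by auto
      then show ?thesis by (simp add: \<xi>_def \<upsilon>_def)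
    qed
    show "(\<lambda>s. L2_norm (\<lambda>t. traj \<tau> s (\<eta>x s) t - x t)) \<longlonglongrightarrow> 0"
      by (rule Lim_transform_eventually[OF x(2)]) (auto simp: eventually_sequentially eq intro!: exI[of _ N0])
    show "(\<lambda>s. L2_norm (\<lambda>t. traj \<tau> s (\<eta>u s) t - u t)) \<longlonglongrightarrow> 0"
      by (rule Lim_transform_eventually[OF u(2)]) (auto simp: eventually_sequentially eq intro!: exI[of _ N0])
  qed
qed

text \<open>The number b stands for the finite value of \<open>J_inf\<close>. Together with
  nonnegativity it makes all costs with s \<ge> 1 real, and it bounds the increasing sequence; the
  shift by \<open>Suc\<close> in the proof leaves out s = 0, about which nothing is assumed.\<close>

lemma second_approximation:
  fixes XT :: "nat \<Rightarrow> ('n::finite) param set" and UT :: "nat \<Rightarrow> ('m::finite) param set"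
  assumes step: "\<And>s. s \<ge> 1 \<Longrightarrow> proj_step \<tau> s ` XT (Suc s) \<subseteq> XT s"
      "\<And>s. s \<ge> 1 \<Longrightarrow> proj_step \<tau> s ` UT (Suc s) \<subseteq> UT s"
    and bound: "\<And>s. s \<ge> 1 \<Longrightarrow> J2 A B x0 \<tau> XT UT s \<le> ereal b"
  shows "1 \<le> s \<Longrightarrow> s \<le> r \<Longrightarrow> J2 A B x0 \<tau> XT UT s \<le> J2 A B x0 \<tau> XT UT r"
    and "\<exists>l::real. J2 A B x0 \<tau> XT UT \<longlonglongrightarrow> ereal l"
proof -
  let ?J = "J2 A B x0 \<tau> XT UT"
  show mono: "?J s \<le> ?J r" if "1 \<le> s" "s \<le> r" for s r
    using that(2)
  proof (induction r rule: dec_induct)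
    case (step r)
    then have "?J r \<le> ?J (Suc r)"
      using that by (intro J2_le_Suc assms(1,2)) auto
    with step.IH show ?case by (rule order_trans)
  qed simp
  have "\<exists>j\<ge>0. ?J s = ereal j" if "s \<ge> 1" for s
    by (rule ereal_sandwich_real[OF J2_nonneg bound[OF that]])
  then obtain j where j: "\<And>s. s \<ge> 1 \<Longrightarrow> ?J s = ereal (j s)" by metis
  have "incseq (\<lambda>n. j (Suc n))"
    unfolding incseq_def
  proof (intro allI impI)
    fix m n :: nat assume "m \<le> n"
    then show "j (Suc m) \<le> j (Suc n)"
      using mono[of "Suc m" "Suc n"] j[of "Suc m"] j[of "Suc n"] by simp
  qed
  moreover have "\<forall>n. j (Suc n) \<le> b"
  proof
    fix n show "j (Suc n) \<le> b" using bound[of "Suc n"] j[of "Suc n"] by simp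
  qed
  ultimately obtain l where "(\<lambda>n. j (Suc n)) \<longlonglongrightarrow> l"
    by (rule incseq_convergent)
  then have "(\<lambda>n. ?J (Suc n)) \<longlonglongrightarrow> ereal l"
    by (simp add: j)
  then show "\<exists>l::real. ?J \<longlonglongrightarrow> ereal l"
    by (auto simp: filterlim_sequentially_Suc)
qed

end

theorem theorem3p1:
  fixes A :: "real^'n^'n" and B :: "real^'m^'n" and x0 :: "real^'n"
    and X :: "(real^'n) set" and U :: "(real^'m) set"
    and \<tau> :: "nat \<Rightarrow> real \<Rightarrow> real"
    and XS XT :: "nat \<Rightarrow> 'n param set"
    and US UT :: "nat \<Rightarrow> 'm param set"
    and N0 :: nat
  assumes X: "closed X" "convex X" "0 \<in> X"
    and U: "closed U" "convex U" "0 \<in> U"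
    and J_inf_finite: "\<bar>J_inf A B x0 X U\<bar> \<noteq> \<infinity>"
    and unique_minimizers_inf:
      "\<exists>(x, u) \<in> minimizers_inf A B x0 X U. \<forall>(x', u') \<in> minimizers_inf A B x0 X U.
         AE t in lebesgue_on {0..}. x' t = x t \<and> u' t = u t"
    and orthonormal: "orthonormal_L2 \<tau>"
    and basis_ode: "exp_stable_basis \<tau>"
    and XS_US: "\<forall>s\<ge>1. XS s \<subseteq> param_space s \<and> US s \<subseteq> param_space s"
    and XT_UT: "\<forall>s\<ge>1. XT s \<subseteq> param_space s \<and> UT s \<subseteq> param_space s"
    and N0: "N0 \<ge> 1" "\<bar>J1 A B x0 \<tau> XS US N0\<bar> \<noteq> \<infinity>"
  shows
    "((\<forall>s\<ge>1.
         (closed (XS s) \<and> convex (XS s) \<and> closed (US s) \<and> convex (US s)) \<and>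
         (incl \<tau> s ` XS s \<subseteq> XS (Suc s) \<and> incl \<tau> s ` US s \<subseteq> US (Suc s)) \<and>
         ((\<forall>\<eta>x \<in> XS s. \<forall>t\<ge>0. traj \<tau> s \<eta>x t \<in> X) \<and>
          (\<forall>\<eta>u \<in> US s. \<forall>t\<ge>0. traj \<tau> s \<eta>u t \<in> U)))
      \<longrightarrow>
        (\<forall>s r. N0 \<le> s \<and> s \<le> r \<longrightarrow> J1 A B x0 \<tau> XS US r \<le> J1 A B x0 \<tau> XS US s) \<and>
        (\<exists>l::real. J1 A B x0 \<tau> XS US \<longlonglongrightarrow> ereal l) \<and>
        (\<forall>s\<ge>1. J_inf A B x0 X U \<le> J1 A B x0 \<tau> XS US s) \<and>
        (\<forall>s\<ge>N0. \<exists>!\<eta>. \<eta> \<in> minimizers1 A B x0 \<tau> XS US s) \<and>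
        (\<exists>x u. x \<in> L2 \<and> u \<in> L2 \<and>
           (\<forall>\<eta>x \<eta>u. (\<forall>s\<ge>N0. (\<eta>x s, \<eta>u s) \<in> minimizers1 A B x0 \<tau> XS US s) \<longrightarrow>
              (\<lambda>s. L2_norm (\<lambda>t. traj \<tau> s (\<eta>x s) t - x t)) \<longlonglongrightarrow> 0 \<and>
              (\<lambda>s. L2_norm (\<lambda>t. traj \<tau> s (\<eta>u s) t - u t)) \<longlonglongrightarrow> 0)))
     \<and>
     ((\<forall>s\<ge>1.
         (closed (XT s) \<and> convex (XT s) \<and> closed (UT s) \<and> convex (UT s)) \<and>
         (proj_step \<tau> s ` XT (Suc s) \<subseteq> XT s \<and> proj_step \<tau> s ` UT (Suc s) \<subseteq> UT s) \<and>
         ((\<forall>x \<in> L2. (\<forall>t\<ge>0. x t \<in> X) \<longrightarrow> proj \<tau> s x \<in> XT s) \<and>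
          (\<forall>u \<in> L2. (\<forall>t\<ge>0. u t \<in> U) \<longrightarrow> proj \<tau> s u \<in> UT s)))
      \<longrightarrow>
        (\<forall>s r. 1 \<le> s \<and> s \<le> r \<longrightarrow> J2 A B x0 \<tau> XT UT s \<le> J2 A B x0 \<tau> XT UT r) \<and>
        (\<exists>l::real. J2 A B x0 \<tau> XT UT \<longlonglongrightarrow> ereal l) \<and>
        (\<forall>s\<ge>1. J2 A B x0 \<tau> XT UT s \<le> J_inf A B x0 X U))"
proof -
  obtain D where D: "\<And>k l. k < l \<Longrightarrow> D k l = 0"
    "\<And>k t. t \<ge> 0 \<Longrightarrow> (\<tau> k has_real_derivative (\<Sum>l\<le>k. D k l * \<tau> l t)) (at t within {0..})"
    using exp_stable_basis_coeffs[OF basis_ode] by blast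
  interpret L2_basis \<tau> D
    by unfold_locales (use orthonormal D in auto)
  obtain b where b: "J_inf A B x0 X U = ereal b"
    using J_inf_finite by (cases "J_inf A B x0 X U") auto
  show ?thesis (is "(?P1 \<longrightarrow> ?Q1) \<and> (?P2 \<longrightarrow> ?Q2)")
  proof (intro conjI[of "?P1 \<longrightarrow> ?Q1"] impI)
    assume P: ?P1
    have "closed (XS s)" "closed (US s)" "convex (XS s)" "convex (US s)"
      "XS s \<subseteq> param_space s" "US s \<subseteq> param_space s"
      "incl \<tau> s ` XS s \<subseteq> XS (Suc s)" "incl \<tau> s ` US s \<subseteq> US (Suc s)" if "s \<ge> 1" for s
      using P XS_US that by auto
    note * = first_approximation[of XS US N0 A B x0, OF this N0]
    have "J_inf A B x0 X U \<le> J1 A B x0 \<tau> XS US s" if "s \<ge> 1" for s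
      using P that by (intro J_inf_le_J1) auto
    then show ?Q1 using * by blast
  next
    assume P: ?P2
    have le: "J2 A B x0 \<tau> XT UT s \<le> J_inf A B x0 X U" if "s \<ge> 1" for s
      using P that by (intro J2_le_J_inf) auto
    have "proj_step \<tau> s ` XT (Suc s) \<subseteq> XT s" "proj_step \<tau> s ` UT (Suc s) \<subseteq> UT s" if "s \<ge> 1" for s
      using P that by auto
    note second_approximation[of XT UT A B x0 b, OF this le[unfolded b]]
    with le show ?Q2 by blast
  qed
qed

end
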